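(* Let $(X,\lambda)$ be a standard $\sigma$-finite space. The natural boolean action of $\mathrm{Aut}(X,\lambda)$ on $(X,\lambda)$ does not admit a spatial model.
   Context: A standard Borel space is an uncountable measurable space whose $\sigma$-algebra is the Borel $\sigma$-algebra of some Polish topology. A standard $\sigma$-finite space $(X,\lambda)$ is a standard Borel space $X$ with a nontrivial (nonzero) atomless $\sigma$-finite Borel measure $\lambda$. A measure-preserving bijection of $(X,\lambda)$ is a Borel bijection $X\to X$ preserving $\lambda$. $\mathrm{Aut}(X,\lambda)$ is the group of measure-preserving bijections of $(X,\lambda)$, identified when they coincide on a conull set. It is a Polish group for the weak topology: $T_n\to T$ iff $\lambda(T_n(A)\,\triangle\, T(A))\to 0$ for every Borel $A$ of finite measure. Let $G$ be a Polish group. A boolean measure-preserving $G$-action on $(X,\lambda)$ is a Borel map $\alpha:G\times X\to X$ such that (i) for all $g,h\in G$, $\alpha(gh,x)=\alpha(g,\alpha(h,x))$ for $\lambda$-almost every $x\in X$, and (ii) for every $g\in G$, $\alpha(g,\cdot)$ is a measure-preserving bijection of $(X,\lambda)$. It is spatial if moreover it is a genuine action, i.e. the equality in (i) holds for all $x\in X$ and $\alpha(e_G,x)=x$ for all $x$. Boolean $G$-actions correspond to continuous homomorphisms $G\to \mathrm{Aut}(X,\lambda)$ via $g\mapsto[\alpha(g,\cdot)]$ (every such homomorphism has a lift $\alpha$, unique up to boolean isomorphism); the natural boolean action of $\mathrm{Aut}(X,\lambda)$ is the one corresponding to the identity homomorphism. Two boolean $G$-actions $\alpha$ on $(X,\lambda)$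 and $\beta$ on $(Y,\eta)$ are booleanly isomorphic if there is a measure-preserving Borel injection $\Phi:X_0\to Y$, with $X_0\subseteq X$ conull Borel, such that for every $g\in G$ there is a conull Borel $X_g\subseteq X_0$ with $\Phi(\alpha(g,x))=\beta(g,\Phi(x))$ for all $x\in X_g$. A boolean $G$-action admits a spatial model if it is booleanly isomorphic to a spatial measure-preserving $G$-action on some standard $\sigma$-finite space. *)

theory Defs
  imports "HOL-Analysis.Analysis" "HOL-Algebra.Group"
begin

definition borel_of :: "'a topology \<Rightarrow> 'a measure" where
  "borel_of T = sigma (topspace T) {U. openin T U}"

definition polish_topology :: "'a topology \<Rightarrow> bool" where
  "polish_topology T \<longleftrightarrow> completely_metrizable_space T \<and> separable_space T"

definition standard_borel_space :: "'a measure \<Rightarrow> bool" where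
  "standard_borel_space M \<longleftrightarrow>
     uncountable (space M) \<and>
     (\<exists>T. polish_topology T \<and> topspace T = space M \<and> sets M = sets (borel_of T))"

definition atomless :: "'a measure \<Rightarrow> bool" where
  "atomless M \<longleftrightarrow>
     (\<forall>A\<in>sets M. 0 < emeasure M A \<longrightarrow>
        (\<exists>B\<in>sets M. B \<subseteq> A \<and> 0 < emeasure M B \<and> emeasure M B < emeasure M A))"

definition standard_sigma_finite_space :: "'a measure \<Rightarrow> bool" where
  "standard_sigma_finite_space M \<longleftrightarrow>
     standard_borel_space M \<and> emeasure M (space M) \<noteq> 0 \<and> atomless M \<and> sigma_finite_measure M"

text \<open>
  Values of a function outside \<open>space M\<close> are irrelevant. Since only standard Borel spaces are
  considered, measurability of the inverse is automatic (Lusin--Souslin) and not required here.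
\<close>
definition mp_bijection :: "'a measure \<Rightarrow> ('a \<Rightarrow> 'a) \<Rightarrow> bool" where
  "mp_bijection M T \<longleftrightarrow>
     bij_betw T (space M) (space M) \<and> T \<in> M \<rightarrow>\<^sub>M M \<and> distr M M T = M"

definition ae_eq_rel :: "'a measure \<Rightarrow> (('a \<Rightarrow> 'a) \<times> ('a \<Rightarrow> 'a)) set" where
  "ae_eq_rel M = {(S, T). mp_bijection M S \<and> mp_bijection M T \<and> (AE x in M. S x = T x)}"

definition aut_group :: "'a measure \<Rightarrow> ('a \<Rightarrow> 'a) set monoid" where
  "aut_group M =
     \<lparr>carrier = {T. mp_bijection M T} // ae_eq_rel M,
      monoid.mult = (\<lambda>a b. \<Union>S\<in>a. \<Union>T\<in>b. ae_eq_rel M `` {S \<circ> T}),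
      one = ae_eq_rel M `` {id}\<rparr>"

text \<open>
  The weak topology is the coarsest one for which every evaluation \<open>T \<mapsto> T(A)\<close>, with \<open>A\<close> of
  finite measure, is continuous into the measure algebra with the distance \<open>\<lambda>(B \<triangle> C)\<close>;
  convergence in it means \<open>\<lambda>(T\<^sub>n(A) \<triangle> T(A)) \<longrightarrow> 0\<close> for all such \<open>A\<close>.
\<close>
definition weak_topology :: "'a measure \<Rightarrow> ('a \<Rightarrow> 'a) set topology" where
  "weak_topology M = topology_generated_by
     {{c \<in> carrier (aut_group M). \<exists>S\<in>c. emeasure M (sym_diff (S ` A) (T ` A)) < ennreal \<epsilon>} | T A \<epsilon>.
        mp_bijection M T \<and> A \<in> sets M \<and> emeasure M A < \<infinity> \<and> \<epsilon> > 0}"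

text \<open>
  In what follows, \<open>G\<close> with the topology \<open>\<tau>\<close> is meant to be a Polish group. The definitions make
  sense without this, so it is not built into them.
\<close>
definition boolean_action ::
  "('g, 'm) monoid_scheme \<Rightarrow> 'g topology \<Rightarrow> 'a measure \<Rightarrow> ('g \<times> 'a \<Rightarrow> 'a) \<Rightarrow> bool" where
  "boolean_action G \<tau> M \<alpha> \<longleftrightarrow>
     \<alpha> \<in> borel_of \<tau> \<Otimes>\<^sub>M M \<rightarrow>\<^sub>M M \<and>
     (\<forall>g\<in>carrier G. \<forall>h\<in>carrier G. AE x in M. \<alpha> (g \<otimes>\<^bsub>G\<^esub> h, x) = \<alpha> (g, \<alpha> (h, x))) \<and>
     (\<forall>g\<in>carrier G. mp_bijection M (\<lambda>x. \<alpha> (g, x)))"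

definition spatial_action ::
  "('g, 'm) monoid_scheme \<Rightarrow> 'g topology \<Rightarrow> 'a measure \<Rightarrow> ('g \<times> 'a \<Rightarrow> 'a) \<Rightarrow> bool" where
  "spatial_action G \<tau> M \<alpha> \<longleftrightarrow>
     boolean_action G \<tau> M \<alpha> \<and>
     (\<forall>g\<in>carrier G. \<forall>h\<in>carrier G. \<forall>x\<in>space M. \<alpha> (g \<otimes>\<^bsub>G\<^esub> h, x) = \<alpha> (g, \<alpha> (h, x))) \<and>
     (\<forall>x\<in>space M. \<alpha> (\<one>\<^bsub>G\<^esub>, x) = x)"

text \<open>
  Measure preservation of \<open>\<Phi> : X\<^sub>0 \<rightarrow> Y\<close> means that the push-forward of the measure of \<open>X\<^sub>0\<close> is the
  measure of \<open>Y\<close>; in particular the image of \<open>\<Phi>\<close> is conull.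
\<close>
definition booleanly_isomorphic ::
  "('g, 'm) monoid_scheme \<Rightarrow> 'a measure \<Rightarrow> ('g \<times> 'a \<Rightarrow> 'a) \<Rightarrow> 'b measure \<Rightarrow> ('g \<times> 'b \<Rightarrow> 'b) \<Rightarrow> bool"
where
  "booleanly_isomorphic G M \<alpha> N \<beta> \<longleftrightarrow>
     (\<exists>X\<^sub>0 \<Phi>. X\<^sub>0 \<in> sets M \<and> space M - X\<^sub>0 \<in> null_sets M \<and>
        \<Phi> \<in> restrict_space M X\<^sub>0 \<rightarrow>\<^sub>M N \<and> inj_on \<Phi> X\<^sub>0 \<and> distr (restrict_space M X\<^sub>0) N \<Phi> = N \<and>
        (\<forall>g\<in>carrier G. \<exists>X\<^sub>g\<in>sets M. X\<^sub>g \<subseteq> X\<^sub>0 \<and> space M - X\<^sub>g \<in> null_sets M \<and>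
           (\<forall>x\<in>X\<^sub>g. \<alpha> (g, x) \<in> X\<^sub>0 \<and> \<Phi> (\<alpha> (g, x)) = \<beta> (g, \<Phi> x))))"

text \<open>
  The type argument names the type carrying the candidate models. HOL cannot quantify over types
  inside a formula; a theorem in which this type is a free type variable speaks about all of them.
\<close>
definition admits_spatial_model ::
  "'b itself \<Rightarrow> ('g, 'm) monoid_scheme \<Rightarrow> 'g topology \<Rightarrow> 'a measure \<Rightarrow> ('g \<times> 'a \<Rightarrow> 'a) \<Rightarrow> bool"
where
  "admits_spatial_model TYPE('b) G \<tau> M \<alpha> \<longleftrightarrow>
     (\<exists>(N :: 'b measure) \<beta>. standard_sigma_finite_space N \<and> spatial_action G \<tau> N \<beta> \<and>
        booleanly_isomorphic G M \<alpha> N \<beta>)"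

text \<open>
  A boolean action \<open>\<alpha>\<close> corresponds to the homomorphism sending \<open>g\<close> to the class of \<open>\<alpha>(g, \<cdot>)\<close>; the
  natural one corresponds to the identity and is determined only up to boolean isomorphism, hence a
  predicate.
\<close>
definition natural_boolean_action ::
  "'a measure \<Rightarrow> (('a \<Rightarrow> 'a) set \<times> 'a \<Rightarrow> 'a) \<Rightarrow> bool" where
  "natural_boolean_action M \<alpha> \<longleftrightarrow>
     boolean_action (aut_group M) (weak_topology M) M \<alpha> \<and>
     (\<forall>g\<in>carrier (aut_group M). ae_eq_rel M `` {\<lambda>x. \<alpha> (g, x)} = g)"

end

(*
  Choose a measure-preserving involution f without fixed points on a set B of positive finite
  measure, together with countably many f-invariant subsets of B such that every point of B lies in
  arbitrarily small ones. For an f-invariant set A let T_A be f on A and the identity elsewhere.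
  The closure H of the group generated by the small sets, under symmetric difference and with the
  distance "measure of the symmetric difference", is a complete pseudometric group of exponent two,
  and A \<mapsto> [T_A] is a continuous homomorphism from H to the automorphism group.

  In a spatial model H acts genuinely. For almost every point y over B the stabiliser of y is dense
  in H: whatever a finite combination C of small sets does to y, some arbitrarily small b undoes it.
  By Baire category the Borel orbit map of y is constant on a comeager subset of H (a Borel set
  invariant under a dense subgroup is meager or comeager), so y is fixed by all of H. But small
  sets around the point move it.
*)

theory Submission
  imports Defs "HOL-Probability.Weak_Convergence"
begin

section \<open>Baire category in complete pseudometric groups\<close>

text \<open>In a boolean isomorphism the null set where equivariance fails depends on the group
  element, so one point \<open>x\<close> can be made good only for countably many flips at once.
  This is why \<open>gen_sets\<close> is countable and why stabilisers are sought inside it. The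
  contradiction too occurs at an element \<open>b\<close> of \<open>gen_sets\<close>; the closure is
  taken because Baire category needs completeness. Using a single involution makes all flips commute
  and have order two, so translation by \<open>k\<close> undoes itself. Sets that differ by a null
  set stay distinct: then A -> \<open>flip A\<close> is an exact homomorphism into maps, at the
  price of a mere pseudometric. The involution is the reflection c -> 1 - c of (0,1), carried over
  to a piece of \<open>M\<close> of finite measure by a distribution function. Images under
  arbitrary measure-preserving bijections enter the weak topology without being known to be
  measurable; only images under flips and under an explicit embedding into the line have to be
  measurable, and for these it is proved directly.\<close>

locale complete_pseudometric =
  fixes H :: "'h set" and d :: "'h \<Rightarrow> 'h \<Rightarrow> real"
  assumes d_self: "x \<in> H \<Longrightarrow> d x x = 0"
    and d_sym: "x \<in> H \<Longrightarrow> y \<in> H \<Longrightarrow> d x y = d y x"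
    and d_tri: "x \<in> H \<Longrightarrow> y \<in> H \<Longrightarrow> z \<in> H \<Longrightarrow> d x z \<le> d x y + d y z"
    and d_complete: "(\<And>n. s n \<in> H) \<Longrightarrow> (\<And>n. d (s n) (s (Suc n)) \<le> (1/2)^n) \<Longrightarrow>
          \<exists>x\<in>H. (\<lambda>n. d (s n) x) \<longlonglongrightarrow> 0"
begin

definition pball :: "'h \<Rightarrow> real \<Rightarrow> 'h set" where
  "pball x r = {y\<in>H. d x y < r}"

definition popen :: "'h set \<Rightarrow> bool" where
  "popen S \<longleftrightarrow> S \<subseteq> H \<and> (\<forall>x\<in>S. \<exists>r>0. pball x r \<subseteq> S)"

text \<open>Phrased by balls instead of closure and interior. \<open>S\<close> may stick out of
  \<open>H\<close>, which is why translates are formed of \<open>S \<inter> H\<close>.\<close>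

definition nowhere_dense :: "'h set \<Rightarrow> bool" where
  "nowhere_dense S \<longleftrightarrow>
     (\<forall>x\<in>H. \<forall>r>0. \<exists>y\<in>H. \<exists>s>0. pball y s \<subseteq> pball x r \<and> pball y s \<inter> S = {})"

definition meager :: "'h set \<Rightarrow> bool" where
  "meager S \<longleftrightarrow> (\<exists>F::nat \<Rightarrow> 'h set. (\<forall>n. nowhere_dense (F n)) \<and> S \<subseteq> (\<Union>n. F n))"

lemma centre_in_pball: "x \<in> H \<Longrightarrow> 0 < r \<Longrightarrow> x \<in> pball x r"
  by (simp add: pball_def d_self)

lemma pball_mono: "r \<le> s \<Longrightarrow> pball x r \<subseteq> pball x s"
  by (auto simp: pball_def)

lemma popen_pball: "x \<in> H \<Longrightarrow> popen (pball x r)"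
  unfolding popen_def
proof (intro conjI ballI)
  fix y assume x: "x \<in> H" and y: "y \<in> pball x r"
  have "pball y (r - d x y) \<subseteq> pball x r"
  proof
    fix z assume z: "z \<in> pball y (r - d x y)"
    then have "d x z \<le> d x y + d y z"
      using x y by (intro d_tri) (auto simp: pball_def)
    with z show "z \<in> pball x r" by (auto simp: pball_def)
  qed
  then show "\<exists>s>0. pball y s \<subseteq> pball x r"
    using y by (intro exI[of _ "r - d x y"]) (auto simp: pball_def)
qed (auto simp: pball_def)

lemma popen_Int: "popen S \<Longrightarrow> popen T \<Longrightarrow> popen (S \<inter> T)"
  unfolding popen_def
proof (intro conjI ballI, blast)
  fix x assume S: "S \<subseteq> H \<and> (\<forall>x\<in>S. \<exists>r>0. pball x r \<subseteq> S)"
    and T: "T \<subseteq> H \<and> (\<forall>x\<in>T. \<exists>r>0. pball x r \<subseteq> T)" and x: "x \<in> S \<inter> T"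
  obtain r s where "r > 0" "pball x r \<subseteq> S" "s > 0" "pball x s \<subseteq> T" using S T x by blast
  then show "\<exists>r>0. pball x r \<subseteq> S \<inter> T"
    using pball_mono[of "min r s" r x] pball_mono[of "min r s" s x]
    by (intro exI[of _ "min r s"]) auto
qed

lemma popen_Union: "(\<And>S. S \<in> \<S> \<Longrightarrow> popen S) \<Longrightarrow> popen (\<Union>\<S>)"
  unfolding popen_def by (meson Union_iff Union_least Sup_upper subset_trans)

lemma meager_subset: "meager T \<Longrightarrow> S \<subseteq> T \<Longrightarrow> meager S"
  unfolding meager_def by (meson subset_trans)

lemma nowhere_dense_imp_meager: "nowhere_dense S \<Longrightarrow> meager S"
  unfolding meager_def by (intro exI[of _ "\<lambda>_. S"]) auto

lemma nowhere_dense_empty: "nowhere_dense {}"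
  unfolding nowhere_dense_def by auto

lemma meager_UN:
  assumes "\<And>i::nat. meager (S i)"
  shows "meager (\<Union>i. S i)"
proof -
  obtain F where F: "\<And>i n. nowhere_dense (F i (n::nat))" "\<And>i. S i \<subseteq> (\<Union>n. F i n)"
    using assms unfolding meager_def by metis
  have "(\<Union>i. S i) \<subseteq> (\<Union>k. case prod_decode k of (i, n) \<Rightarrow> F i n)"
  proof
    fix x assume "x \<in> (\<Union>i. S i)"
    then obtain i n where "x \<in> F i n" using F(2) by blast
    then show "x \<in> (\<Union>k. case prod_decode k of (i, n) \<Rightarrow> F i n)"
      by (intro UN_I[of "prod_encode (i, n)"]) auto
  qed
  then show ?thesis
    unfolding meager_def using F(1)
    by (intro exI[of _ "\<lambda>k. case prod_decode k of (i, n) \<Rightarrow> F i n"]) (auto split: prod.split)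
qed

lemma meager_Un: "meager S \<Longrightarrow> meager T \<Longrightarrow> meager (S \<union> T)"
  by (rule meager_subset[OF meager_UN[of "\<lambda>i. if i = 0 then S else T"]])
     (auto split: if_splits intro: exI[of _ "0::nat"] exI[of _ "1::nat"])

text \<open>Nested balls with radii at most \<open>(1/2)^n\<close> are chosen, the next one avoiding
  \<open>F n\<close>; their centres then satisfy exactly the geometric bound in
  \<open>d_complete\<close>.\<close>

theorem Baire:
  assumes "x \<in> H" "0 < r"
  shows "\<not> meager (pball x r)"
proof
  assume "meager (pball x r)"
  then obtain F where F: "\<And>n::nat. nowhere_dense (F n)" "pball x r \<subseteq> (\<Union>n. F n)"
    unfolding meager_def by blast
  have step: "\<exists>q. fst q \<in> H \<and> 0 < snd q \<and> snd q \<le> (1/2)^Suc n \<and>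
      pball (fst q) (2 * snd q) \<subseteq> pball (fst p) (snd p) \<and> pball (fst q) (2 * snd q) \<inter> F n = {}"
    if p: "fst p \<in> H" "0 < snd p" for p and n
  proof -
    obtain y s where ys: "y \<in> H" "s > 0" "pball y s \<subseteq> pball (fst p) (snd p)" "pball y s \<inter> F n = {}"
      using F(1)[of n] p unfolding nowhere_dense_def by blast
    \<comment> \<open>The limit of the centres is only known to lie in the ball of twice the radius,
      so the doubled ball has to avoid \<open>F n\<close>; hence \<open>s/2\<close>.\<close>
    define t where "t = min (s/2) ((1/2)^Suc n)"
    have "pball y (2*t) \<subseteq> pball y s" by (rule pball_mono) (auto simp: t_def)
    then show ?thesis using ys
      by (intro exI[of _ "(y, t)"]) (auto simp: t_def)
  qed
  \<comment> \<open>Capped at 1 so that the radius bound \<open>(1/2)^n\<close> holds at n =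
    0.\<close>
  define p0 where "p0 = (x, min r 1)"
  have "\<exists>p. \<forall>n. (fst (p n) \<in> H \<and> 0 < snd (p n) \<and> snd (p n) \<le> (1/2)^n \<and> (n = 0 \<longrightarrow> p n = p0)) \<and>
      (pball (fst (p (Suc n))) (2 * snd (p (Suc n))) \<subseteq> pball (fst (p n)) (snd (p n)) \<and>
       pball (fst (p (Suc n))) (2 * snd (p (Suc n))) \<inter> F n = {})"
  proof (rule dependent_nat_choice)
    show "\<exists>a. fst a \<in> H \<and> 0 < snd a \<and> snd a \<le> (1/2)^0 \<and> (0 = (0::nat) \<longrightarrow> a = p0)"
      using assms by (intro exI[of _ p0]) (auto simp: p0_def)
  next
    fix a and n :: nat
    assume "fst a \<in> H \<and> 0 < snd a \<and> snd a \<le> (1/2)^n \<and> (n = 0 \<longrightarrow> a = p0)"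
    then obtain q where "fst q \<in> H \<and> 0 < snd q \<and> snd q \<le> (1/2)^Suc n \<and>
      pball (fst q) (2 * snd q) \<subseteq> pball (fst a) (snd a) \<and> pball (fst q) (2 * snd q) \<inter> F n = {}"
      using step[of a n] by blast
    then show "\<exists>b. (fst b \<in> H \<and> 0 < snd b \<and> snd b \<le> (1/2)^Suc n \<and> (Suc n = 0 \<longrightarrow> b = p0)) \<and>
      pball (fst b) (2 * snd b) \<subseteq> pball (fst a) (snd a) \<and> pball (fst b) (2 * snd b) \<inter> F n = {}"
      by auto
  qed
  then obtain p where p: "\<And>n. fst (p n) \<in> H \<and> 0 < snd (p n) \<and> snd (p n) \<le> (1/2)^n \<and>
         (n = 0 \<longrightarrow> p n = p0)"
    and p': "\<And>n. pball (fst (p (Suc n))) (2 * snd (p (Suc n))) \<subseteq> pball (fst (p n)) (snd (p n)) \<and>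
         pball (fst (p (Suc n))) (2 * snd (p (Suc n))) \<inter> F n = {}"
    by blast
  define y s where "y = (\<lambda>n. fst (p n))" and "s = (\<lambda>n. snd (p n))"
  have y: "y n \<in> H" "0 < s n" "s n \<le> (1/2)^n" for n using p by (auto simp: y_def s_def)
  have sub: "pball (y (Suc n)) (2 * s (Suc n)) \<subseteq> pball (y n) (s n)"
    and dis: "pball (y (Suc n)) (2 * s (Suc n)) \<inter> F n = {}" for n
    using p' by (auto simp: y_def s_def)
  have mem: "y (n + k) \<in> pball (y n) (s n)" for n k
  proof -
    have "pball (y (n + k)) (s (n + k)) \<subseteq> pball (y n) (s n)"
    proof (induction k)
      case (Suc k)
      have "pball (y (n + Suc k)) (s (n + Suc k)) \<subseteq> pball (y (Suc (n + k))) (2 * s (Suc (n + k)))"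
        using y(2)[of "Suc (n + k)"] by (simp add: pball_mono)
      with sub[of "n + k"] Suc show ?case by auto
    qed simp
    then show ?thesis using centre_in_pball y by blast
  qed
  have "d (y n) (y (Suc n)) \<le> (1/2)^n" for n
    using mem[of n 1] y(3)[of n] by (auto simp: pball_def)
  from d_complete[OF y(1) this] obtain z where z: "z \<in> H" "(\<lambda>n. d (y n) z) \<longlonglongrightarrow> 0"
    by blast
  have zin: "z \<in> pball (y n) (2 * s n)" for n
  proof -
    have "eventually (\<lambda>k. d (y k) z < s n) sequentially"
      using z(2) y(2)[of n] by (rule order_tendstoD)
    then obtain k where k: "k \<ge> n" "d (y k) z < s n"
      unfolding eventually_sequentially by (metis le_cases order_refl)
    have "d (y n) z \<le> d (y n) (y k) + d (y k) z" using y z by (intro d_tri) auto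
    moreover have "d (y n) (y k) < s n" using mem[of n "k - n"] k by (auto simp: pball_def)
    ultimately show ?thesis using k z by (auto simp: pball_def)
  qed
  have "z \<in> pball (y 0) (s 0)" using zin[of 1] sub[of 0] by auto
  moreover have "pball (y 0) (s 0) \<subseteq> pball x r"
    using p[of 0] pball_mono[of "min r 1" r x] by (auto simp: y_def s_def p0_def)
  ultimately obtain n where "z \<in> F n" using F(2) by blast
  with zin[of "Suc n"] dis[of n] show False by blast
qed

definition baire_property :: "'h set \<Rightarrow> bool" where
  "baire_property S \<longleftrightarrow> S \<subseteq> H \<and> (\<exists>U. popen U \<and> meager (sym_diff S U))"

lemma baire_property_popen: "popen U \<Longrightarrow> baire_property U"
  unfolding baire_property_def
  by (intro conjI exI[of _ U])
     (auto simp: popen_def intro: nowhere_dense_imp_meager nowhere_dense_empty)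

text \<open>The open set for the complement is the exterior \<open>V\<close> of \<open>U\<close>.
  What \<open>U\<close> and \<open>V\<close> leave over is the boundary of an open set, which is
  nowhere dense.\<close>

lemma baire_property_Diff:
  assumes "baire_property S"
  shows "baire_property (H - S)"
proof -
  obtain U where U: "popen U" "meager (sym_diff S U)"
    using assms unfolding baire_property_def by blast
  define V where "V = {x\<in>H. \<exists>r>0. pball x r \<inter> U = {}}"
  have "popen V"
    unfolding popen_def
  proof (intro conjI ballI)
    fix x assume "x \<in> V"
    then obtain r where r: "x \<in> H" "r > 0" "pball x r \<inter> U = {}" by (auto simp: V_def)
    have "pball x r \<subseteq> V"
    proof
      fix y assume y: "y \<in> pball x r"
      with popen_pball[OF r(1), of r] obtain s where "s > 0" "pball y s \<subseteq> pball x r"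
        by (auto simp: popen_def)
      with r y show "y \<in> V" by (force simp: V_def pball_def)
    qed
    then show "\<exists>r>0. pball x r \<subseteq> V" using r by blast
  qed (auto simp: V_def)
  moreover have "nowhere_dense (H - U - V)"
    unfolding nowhere_dense_def
  proof (intro ballI allI impI)
    fix x and r :: real assume x: "x \<in> H" and r: "0 < r"
    show "\<exists>y\<in>H. \<exists>s>0. pball y s \<subseteq> pball x r \<and> pball y s \<inter> (H - U - V) = {}"
    proof (cases "pball x r \<inter> U = {}")
      case True
      have "pball x r \<subseteq> V"
      proof
        fix y assume y: "y \<in> pball x r"
        with popen_pball[OF x, of r] obtain s where "s > 0" "pball y s \<subseteq> pball x r"
          by (auto simp: popen_def)
        with True y show "y \<in> V" by (force simp: V_def pball_def)
      qed
      with x r show ?thesis by blast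
    next
      case False
      then obtain y where y: "y \<in> pball x r \<inter> U" by blast
      with popen_Int[OF popen_pball[OF x, of r] U(1)]
      obtain s where "s > 0" "pball y s \<subseteq> pball x r \<inter> U" unfolding popen_def by blast
      with y show ?thesis by (intro bexI[of _ y] exI[of _ s]) (auto simp: pball_def)
    qed
  qed
  then have "meager (H - U - V)" by (rule nowhere_dense_imp_meager)
  with U(2) have "meager (sym_diff S U \<union> (H - U - V))" by (rule meager_Un)
  moreover have "U \<inter> V = {}"
    using U(1) centre_in_pball by (fastforce simp: V_def popen_def)
  then have "sym_diff (H - S) V \<subseteq> sym_diff S U \<union> (H - U - V)"
    by (auto simp: V_def)
  ultimately show ?thesis
    unfolding baire_property_def by (blast intro: meager_subset)
qed

lemma baire_property_UN:
  assumes "\<And>i::nat. baire_property (S i)"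
  shows "baire_property (\<Union>i. S i)"
proof -
  obtain U where U: "\<And>i. popen (U i)" "\<And>i. meager (sym_diff (S i) (U i))"
    using assms unfolding baire_property_def by metis
  have "popen (\<Union>i. U i)" using U(1) by (intro popen_Union) auto
  moreover have "meager (sym_diff (\<Union>i. S i) (\<Union>i. U i))"
    by (rule meager_subset[OF meager_UN[of "\<lambda>i. sym_diff (S i) (U i)"]])
       (use U(2) in auto)
  moreover have "(\<Union>i. S i) \<subseteq> H" using assms unfolding baire_property_def by blast
  ultimately show ?thesis
    unfolding baire_property_def by blast
qed

end

text \<open>\<open>add_cancel\<close> encodes exponent two: every translation is an involution, by
  \<open>d_add\<close> an isometric one.\<close>

locale complete_pseudometric_group = complete_pseudometric H d
  for H :: "'h set" and d +
  fixes add :: "'h \<Rightarrow> 'h \<Rightarrow> 'h"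
  assumes add_closed: "x \<in> H \<Longrightarrow> y \<in> H \<Longrightarrow> add x y \<in> H"
    and add_cancel: "x \<in> H \<Longrightarrow> k \<in> H \<Longrightarrow> add (add x k) k = x"
    and add_comm: "x \<in> H \<Longrightarrow> y \<in> H \<Longrightarrow> add x y = add y x"
    and d_add: "x \<in> H \<Longrightarrow> y \<in> H \<Longrightarrow> k \<in> H \<Longrightarrow> d (add x k) (add y k) = d x y"
begin

lemma translate_pball:
  assumes "x \<in> H" "k \<in> H"
  shows "(\<lambda>h. add h k) ` pball x r = pball (add x k) r"
proof (intro equalityI subsetI)
  fix y assume "y \<in> pball (add x k) r"
  then have y: "y \<in> H" "d (add x k) y < r" by (auto simp: pball_def)
  with assms d_add[of "add x k" y k] have "add y k \<in> pball x r"
    by (auto simp: pball_def add_closed add_cancel)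
  moreover have "y = add (add y k) k" using y assms by (simp add: add_cancel)
  ultimately show "y \<in> (\<lambda>h. add h k) ` pball x r" by blast
qed (use assms in \<open>auto simp: pball_def add_closed d_add\<close>)

lemma inj_on_add: "k \<in> H \<Longrightarrow> inj_on (\<lambda>h. add h k) H"
  by (rule inj_on_inverseI[of _ "\<lambda>h. add h k"]) (simp add: add_cancel)

lemma nowhere_dense_translate:
  assumes S: "nowhere_dense S" and k: "k \<in> H"
  shows "nowhere_dense ((\<lambda>h. add h k) ` (S \<inter> H))"
  unfolding nowhere_dense_def
proof (intro ballI allI impI)
  fix x and r :: real assume x: "x \<in> H" and r: "0 < r"
  obtain y s where ys: "y \<in> H" "s > 0" "pball y s \<subseteq> pball (add x k) r" "pball y s \<inter> S = {}"
    using S x k r add_closed unfolding nowhere_dense_def by metis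
  have "pball (add y k) s = (\<lambda>h. add h k) ` pball y s"
    using translate_pball ys k by simp
  moreover have "pball x r = (\<lambda>h. add h k) ` pball (add x k) r"
    using translate_pball[of "add x k" k r] x k by (simp add: add_closed add_cancel)
  moreover have "(\<lambda>h. add h k) ` pball y s \<inter> (\<lambda>h. add h k) ` (S \<inter> H) = {}"
    using inj_on_image_Int[OF inj_on_add[OF k], of "pball y s" "S \<inter> H"] ys
    by (auto simp: pball_def)
  ultimately show "\<exists>y\<in>H. \<exists>s>0. pball y s \<subseteq> pball x r \<and> pball y s \<inter> (\<lambda>h. add h k) ` (S \<inter> H) = {}"
    using ys k by (intro bexI[of _ "add y k"] exI[of _ s]) (auto simp: add_closed)
qed

lemma meager_translate:
  assumes "meager S" "k \<in> H"
  shows "meager ((\<lambda>h. add h k) ` (S \<inter> H))"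
proof -
  obtain F where F: "\<And>n::nat. nowhere_dense (F n)" "S \<subseteq> (\<Union>n. F n)"
    using assms unfolding meager_def by blast
  then have "(\<lambda>h. add h k) ` (S \<inter> H) \<subseteq> (\<Union>n. (\<lambda>h. add h k) ` (F n \<inter> H))" by blast
  then show ?thesis
    unfolding meager_def using F nowhere_dense_translate assms
    by (intro exI[of _ "\<lambda>n. (\<lambda>h. add h k) ` (F n \<inter> H)"]) auto
qed

text \<open>Topological zero-one law. If it failed, \<open>S\<close> would be comeager in a ball
  around \<open>u\<close> and its complement in a ball around \<open>v\<close>. A translation by
  some \<open>k\<close> in \<open>K\<close> makes the first ball overlap the second; since
  \<open>S\<close> translated by \<open>k\<close> stays in \<open>S\<close>, a ball in the overlap
  is covered by two meager sets.\<close>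

lemma meager_or_comeager:
  assumes S: "baire_property S" and K: "K \<subseteq> H"
    and dense: "\<And>x r. x \<in> H \<Longrightarrow> 0 < r \<Longrightarrow> \<exists>k\<in>K. k \<in> pball x r"
    and inv: "\<And>h k. h \<in> S \<Longrightarrow> k \<in> K \<Longrightarrow> add h k \<in> S"
  shows "meager S \<or> meager (H - S)"
proof (rule ccontr)
  assume "\<not> ?thesis"
  then have nS: "\<not> meager S" and nS': "\<not> meager (H - S)" by auto
  obtain U where U: "popen U" "meager (sym_diff S U)" and SH: "S \<subseteq> H"
    using S unfolding baire_property_def by blast
  obtain V where V: "popen V" "meager (sym_diff (H - S) V)"
    using baire_property_Diff[OF S] unfolding baire_property_def by blast
  have "U \<noteq> {}" using nS U by auto
  then obtain u where u: "u \<in> U" "u \<in> H" using U by (auto simp: popen_def)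
  have "V \<noteq> {}" using nS' V by auto
  then obtain v where v: "v \<in> V" "v \<in> H" using V by (auto simp: popen_def)
  obtain r where r: "r > 0" "pball v r \<subseteq> V" using V(1) v by (auto simp: popen_def)
  obtain r' where r': "r' > 0" "pball u r' \<subseteq> U" using U(1) u by (auto simp: popen_def)
  \<comment> \<open>With exponent two, \<open>add v u\<close> is the difference of \<open>v\<close>
    and \<open>u\<close>, so \<open>add u k\<close> comes within \<open>r\<close> of
    \<open>v\<close>.\<close>
  obtain k where k: "k \<in> K" "k \<in> pball (add v u) (min r r')"
    using dense[of "add v u" "min r r'"] add_closed u v r r' by auto
  then have kH: "k \<in> H" using K by auto
  define w where "w = add u k"
  have wH: "w \<in> H" using u kH by (simp add: w_def add_closed)
  have "d v w = d (add v u) k"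
    using d_add[of v w u] u v kH wH add_cancel[of k u] add_comm[of u k] by (simp add: w_def)
  then have wv: "w \<in> pball v r" using k wH by (auto simp: pball_def)
  have ball: "pball w r' = (\<lambda>h. add h k) ` pball u r'"
    using translate_pball[OF u(2) kH] by (simp add: w_def)
  have "w \<in> pball w r' \<inter> pball v r" using wv centre_in_pball[OF wH r'(1)] by blast
  with popen_Int[OF popen_pball[OF wH, of r'] popen_pball[OF v(2), of r]]
  obtain t where t: "t > 0" "pball w t \<subseteq> pball w r' \<inter> pball v r"
    unfolding popen_def by blast
  have "pball w t \<subseteq> (\<lambda>h. add h k) ` (sym_diff S U \<inter> H) \<union> sym_diff (H - S) V"
  proof
    fix x assume x: "x \<in> pball w t"
    show "x \<in> (\<lambda>h. add h k) ` (sym_diff S U \<inter> H) \<union> sym_diff (H - S) V"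
    proof (cases "x \<in> S")
      case True
      then show ?thesis using x t r by auto
    next
      case False
      obtain y where y: "y \<in> pball u r'" "x = add y k" using x t ball by blast
      then have "y \<in> U" "y \<in> H" "y \<notin> S" using r' False inv k by (auto simp: pball_def)
      then show ?thesis using y by auto
    qed
  qed
  then have "meager (pball w t)"
    using meager_Un[OF meager_translate[OF U(2) kH] V(2)] meager_subset by blast
  then show False using Baire[OF wH t(1)] by blast
qed

text \<open>
  If the stabiliser of \<open>y\<close> is dense, the zero-one law makes the orbit map of \<open>y\<close> constant on a
  comeager set, and two generic translates of this set meet.
\<close>

theorem fixed_if_dense_stabiliser:
  fixes a :: "'h \<Rightarrow> 'y \<Rightarrow> 'y" and A :: "nat \<Rightarrow> 'y set"
  assumes y: "y \<in> Y"
    and closed: "\<And>h z. h \<in> H \<Longrightarrow> z \<in> Y \<Longrightarrow> a h z \<in> Y"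
    and action: "\<And>g h z. g \<in> H \<Longrightarrow> h \<in> H \<Longrightarrow> z \<in> Y \<Longrightarrow> a (add g h) z = a g (a h z)"
    and invol: "\<And>h z. h \<in> H \<Longrightarrow> z \<in> Y \<Longrightarrow> a h (a h z) = z"
    and separating: "\<And>z w. z \<in> Y \<Longrightarrow> w \<in> Y \<Longrightarrow> (\<And>n. z \<in> A n \<longleftrightarrow> w \<in> A n) \<Longrightarrow> z = w"
    and baire: "\<And>n. baire_property {h\<in>H. a h y \<in> A n}"
    and dense: "\<And>x r. x \<in> H \<Longrightarrow> 0 < r \<Longrightarrow> \<exists>k\<in>H. a k y = y \<and> k \<in> pball x r"
    and h: "h \<in> H"
  shows "a h y = y"
proof -
  define S where "S = (\<lambda>n. {h\<in>H. a h y \<in> A n})"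
  have dich: "meager (S n) \<or> meager (H - S n)" for n
  proof (rule meager_or_comeager[where K = "{k\<in>H. a k y = y}"])
    show "baire_property (S n)" using baire by (simp add: S_def)
    show "add g k \<in> S n" if "g \<in> S n" "k \<in> {k\<in>H. a k y = y}" for g k
      using that y by (auto simp: S_def add_closed action)
  qed (use dense in auto)
  \<comment> \<open>Outside \<open>E\<close>, membership in each \<open>S n\<close> no longer
    depends on the group element.\<close>
  define E where "E = (\<Union>n. if meager (S n) then S n else H - S n)"
  have E: "meager E"
    unfolding E_def using dich by (intro meager_UN) auto
  \<comment> \<open>The ball serves only as a nonmeager set: it supplies \<open>g\<close> such that
    neither \<open>g\<close> nor \<open>add g h\<close> lies in \<open>E\<close>.\<close>
  have "\<not> pball h 1 \<subseteq> E \<union> (\<lambda>g. add g h) ` (E \<inter> H)"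
    using Baire[OF h, of 1] meager_subset[OF meager_Un[OF E meager_translate[OF E h]]] by auto
  then obtain g where g: "g \<in> H" "g \<notin> E" "g \<notin> (\<lambda>g. add g h) ` (E \<inter> H)"
    by (auto simp: pball_def)
  have gh: "add g h \<in> H" using g h by (simp add: add_closed)
  have "add g h \<notin> E"
  proof
    assume "add g h \<in> E"
    moreover have "g = add (add g h) h" using g h by (simp add: add_cancel)
    ultimately show False using g gh by blast
  qed
  then have "g \<in> S n \<longleftrightarrow> add g h \<in> S n" for n
    using g gh unfolding E_def by (auto split: if_splits)
  then have "a g y = a (add g h) y"
    using g gh y by (intro separating) (auto simp: S_def closed)
  also have "\<dots> = a g (a h y)" using g h y by (simp add: action)
  finally have "a g (a g y) = a g (a g (a h y))" by simp
  then show ?thesis using g h y by (simp add: invol closed)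
qed

end

section \<open>Standard Borel spaces as Borel subsets of the line\<close>

text \<open>Bits are stored in base four as digits 0 and 1: the remainder after any digit stays
  below 1, so no carry occurs and the bits can be read off. The floor has the form 4k + bit, and its
  parity is the bit.\<close>

definition quaternary_digit :: "nat \<Rightarrow> real \<Rightarrow> bool" where
  "quaternary_digit n t \<longleftrightarrow> odd \<lfloor>4 ^ Suc n * t\<rfloor>"

definition quaternary :: "(nat \<Rightarrow> bool) \<Rightarrow> real" where
  "quaternary b = (\<Sum>n. of_bool (b n) * (1/4) ^ Suc n)"

lemma summable_quaternary: "summable (\<lambda>n. of_bool (b n) * (1/4::real) ^ Suc n)"
  by (rule summable_comparison_test'[where g="\<lambda>n. (1/4::real) ^ n" and N=0]) auto

lemma quaternary_Suc: "4 * quaternary b = of_bool (b 0) + quaternary (\<lambda>n. b (Suc n))"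
  using suminf_split_head[OF summable_quaternary[of b]]
    suminf_mult[OF summable_quaternary[of "\<lambda>n. b (Suc n)"], of "1/4"]
  by (simp add: quaternary_def mult_ac)

lemma quaternary_bounds: "0 \<le> quaternary b" "quaternary b < 1"
proof -
  show "0 \<le> quaternary b"
    unfolding quaternary_def by (rule suminf_nonneg[OF summable_quaternary]) auto
  have "quaternary b \<le> (\<Sum>n. (1/4::real) * (1/4) ^ n)"
    unfolding quaternary_def by (rule suminf_le[OF _ summable_quaternary]) auto
  also have "\<dots> = 1/3" by (subst suminf_mult) (auto simp: suminf_geometric)
  finally show "quaternary b < 1" by simp
qed

lemma quaternary_digit_quaternary: "quaternary_digit n (quaternary b) = b n"
proof -
  have "\<exists>k::int. 4 ^ n * quaternary b = k + quaternary (\<lambda>i. b (i + n))"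
  proof (induction n)
    case (Suc n)
    then obtain k :: int where "4 ^ n * quaternary b = k + quaternary (\<lambda>i. b (i + n))" by blast
    then have "4 ^ Suc n * quaternary b = 4 * k + 4 * quaternary (\<lambda>i. b (i + n))" by simp
    also have "\<dots> = of_int (4 * k + of_bool (b n)) + quaternary (\<lambda>i. b (i + Suc n))"
      by (simp add: quaternary_Suc[of "\<lambda>i. b (i + n)"])
    finally show ?case by blast
  qed (auto intro: exI[of _ 0])
  then obtain k :: int where "4 ^ n * quaternary b = k + quaternary (\<lambda>i. b (i + n))" by blast
  then have "4 ^ Suc n * quaternary b = 4 * k + 4 * quaternary (\<lambda>i. b (i + n))" by simp
  also have "\<dots> = of_int (4 * k + of_bool (b n)) + quaternary (\<lambda>i. b (i + Suc n))"
    by (simp add: quaternary_Suc[of "\<lambda>i. b (i + n)"])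
  finally have "\<lfloor>4 ^ Suc n * quaternary b\<rfloor> = 4 * k + of_bool (b n)"
    using quaternary_bounds[of "\<lambda>i. b (i + Suc n)"] by linarith
  then show ?thesis by (simp add: quaternary_digit_def)
qed

lemma quaternary_digit_measurable [measurable]:
  "Measurable.pred borel (quaternary_digit n)"
  unfolding quaternary_digit_def[abs_def] by measurable

lemma quaternary_measurable [measurable]:
  assumes [measurable]: "\<And>n. Measurable.pred M (\<lambda>x. b x n)"
  shows "(\<lambda>x. quaternary (b x)) \<in> borel_measurable M"
  unfolding quaternary_def by measurable

context Metric_space
begin

text \<open>
  A family \<open>b\<close> of basic balls is the family of all basic balls containing some fixed point iff it
  is linked, contains arbitrarily small balls, and consists exactly of those balls into which
  another of its members fits with room to spare. This is a countable condition on \<open>b\<close>.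
\<close>

lemma point_filter_iff:
  fixes c :: "nat \<Rightarrow> 'a" and r :: "nat \<Rightarrow> real"
  assumes complete: mcomplete and c: "\<And>n. c n \<in> M" and r: "\<And>n. 0 < r n"
    and base: "\<And>x \<epsilon>. x \<in> M \<Longrightarrow> 0 < \<epsilon> \<Longrightarrow> \<exists>n. x \<in> mball (c n) (r n) \<and> r n < \<epsilon>"
  shows "(\<exists>x\<in>M. \<forall>n. b n \<longleftrightarrow> x \<in> mball (c n) (r n)) \<longleftrightarrow>
     (\<forall>k::nat. \<exists>n. b n \<and> r n < 1 / Suc k) \<and>
     (\<forall>m n. b m \<and> b n \<longrightarrow> mball (c m) (r m) \<inter> mball (c n) (r n) \<noteq> {}) \<and>
     (\<forall>n. b n \<longleftrightarrow> (\<exists>m. b m \<and> d (c m) (c n) + r m < r n))"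
    (is "?lhs \<longleftrightarrow> ?small \<and> ?linked \<and> ?room")
proof
  assume ?lhs
  then obtain x where x: "x \<in> M" and b: "\<And>n. b n \<longleftrightarrow> x \<in> mball (c n) (r n)" by blast
  have ?small using base[OF x] b by simp
  moreover have ?linked using b by blast
  moreover have ?room
  proof
    fix n
    show "b n \<longleftrightarrow> (\<exists>m. b m \<and> d (c m) (c n) + r m < r n)"
    proof
      assume "b n"
      \<comment> \<open>Half of the slack, because \<open>r m\<close> is spent twice: as a bound for
        \<open>d (c m) x\<close> and as the radius itself.\<close>
      then have "0 < (r n - d (c n) x) / 2" using b x by auto
      from base[OF x this] obtain m where m: "x \<in> mball (c m) (r m)" "r m < (r n - d (c n) x) / 2"
        by blast
      have "d (c m) (c n) \<le> d (c m) x + d (c n) x" using c x by (intro triangle') auto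
      with m have "d (c m) (c n) + r m < r n" by (auto simp: field_simps)
      with m b show "\<exists>m. b m \<and> d (c m) (c n) + r m < r n" by blast
    next
      assume "\<exists>m. b m \<and> d (c m) (c n) + r m < r n"
      then obtain m where m: "b m" "d (c m) (c n) + r m < r n" by blast
      then have "d (c m) x < r m" using b by auto
      moreover have "d (c n) x \<le> d (c n) (c m) + d (c m) x" using c x by (intro triangle) auto
      ultimately show "b n" using m b c x by (simp add: commute)
    qed
  qed
  ultimately show "?small \<and> ?linked \<and> ?room" by blast
next
  assume "?small \<and> ?linked \<and> ?room"
  then have small: ?small and linked: ?linked and room: ?room by blast+
  obtain s where s: "\<And>k. b (s k) \<and> r (s k) < 1 / Suc k" using small by metis
  have near: "d (c m) (c n) < r m + r n" if mn: "b m" "b n" for m n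
  proof -
    obtain z where z: "z \<in> mball (c m) (r m)" "z \<in> mball (c n) (r n)"
      using linked mn by blast
    then have "d (c m) (c n) \<le> d (c m) z + d (c n) z" using c by (intro triangle') auto
    with z show ?thesis by auto
  qed
  have inv: "\<exists>N. \<forall>n\<ge>N. 1 / real (Suc n) < \<epsilon>" if eps: "0 < \<epsilon>" for \<epsilon> :: real
  proof -
    obtain N where N: "1 / real (Suc N) < \<epsilon>" using nat_approx_posE eps by blast
    have "1 / real (Suc n) < \<epsilon>" if "n \<ge> N" for n
      by (rule le_less_trans[OF _ N]) (use that in \<open>simp add: frac_le\<close>)
    then show ?thesis by blast
  qed
  have "MCauchy (\<lambda>k. c (s k))"
    unfolding MCauchy_def
  proof (intro conjI allI impI)
    fix \<epsilon> :: real assume "0 < \<epsilon>"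
    with inv[of "\<epsilon>/2"] obtain N where N: "\<And>n. n \<ge> N \<Longrightarrow> 1 / real (Suc n) < \<epsilon>/2" by auto
    show "\<exists>N. \<forall>n n'. N \<le> n \<longrightarrow> N \<le> n' \<longrightarrow> d (c (s n)) (c (s n')) < \<epsilon>"
    proof (intro exI[of _ N] allI impI)
      fix n n' assume "N \<le> n" "N \<le> n'"
      then show "d (c (s n)) (c (s n')) < \<epsilon>"
        using near[of "s n" "s n'"] s[of n] s[of n'] N[of n] N[of n'] by auto
    qed
  qed (use c in auto)
  then obtain x where x: "limitin mtopology (\<lambda>k. c (s k)) x sequentially"
    using complete by (auto simp: mcomplete_def)
  then have xM: "x \<in> M" using limitin_mspace by blast
  have conv: "\<exists>k. d (c (s k)) x < \<epsilon> \<and> r (s k) < \<epsilon>" if eps: "0 < \<epsilon>" for \<epsilon>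
  proof -
    obtain N where N: "\<And>n. n \<ge> N \<Longrightarrow> d (c (s n)) x < \<epsilon>"
      using x eps unfolding limit_metric_sequentially by meson
    obtain N' where N': "\<And>n. n \<ge> N' \<Longrightarrow> 1 / real (Suc n) < \<epsilon>" using inv eps by blast
    show ?thesis
      using N[of "max N N'"] N'[of "max N N'"] s[of "max N N'"]
      by (intro exI[of _ "max N N'"]) auto
  qed
  \<comment> \<open>The limit point lies only in the closed balls; the room condition then restores
    strictness by passing to a smaller member of the family.\<close>
  have le: "d (c m) x \<le> r m" if "b m" for m
  proof (rule field_le_epsilon)
    fix \<epsilon> :: real assume "0 < \<epsilon>"
    with conv[of "\<epsilon>/2"] obtain k where k: "d (c (s k)) x < \<epsilon>/2" "r (s k) < \<epsilon>/2" by auto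
    have "d (c m) x \<le> d (c m) (c (s k)) + d (c (s k)) x" using c xM by (intro triangle) auto
    with k near[OF \<open>b m\<close>, of "s k"] s[of k] show "d (c m) x \<le> r m + \<epsilon>" by auto
  qed
  have "b n \<longleftrightarrow> x \<in> mball (c n) (r n)" for n
  proof
    assume "b n"
    then obtain m where m: "b m" "d (c m) (c n) + r m < r n" using room by blast
    have "d (c n) x \<le> d (c n) (c m) + d (c m) x" using c xM by (intro triangle) auto
    with m le[of m] show "x \<in> mball (c n) (r n)" using c xM by (simp add: commute)
  next
    assume "x \<in> mball (c n) (r n)"
    then have "0 < (r n - d (c n) x) / 2" by auto
    from conv[OF this] obtain k
      where k: "d (c (s k)) x < (r n - d (c n) x) / 2" "r (s k) < (r n - d (c n) x) / 2" by blast
    have "d (c (s k)) (c n) \<le> d (c (s k)) x + d (c n) x" using c xM by (intro triangle') auto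
    with k have "d (c (s k)) (c n) + r (s k) < r n" by (auto simp: field_simps)
    with s[of k] show "b n" using room by blast
  qed
  with xM show ?lhs by blast
qed

end

text \<open>A point is coded by the bits telling which balls of a countable base contain it. The
  image of the whole space is Borel because \<open>point_filter_iff\<close> turns the existence of a
  coded point into countably many conditions on digits; the other images follow by induction over
  the sigma-algebra, with injectivity for complements.\<close>

lemma standard_borel_real_embedding:
  assumes "standard_borel_space M"
  obtains \<psi> :: "'a \<Rightarrow> real" where "inj_on \<psi> (space M)" "\<psi> \<in> borel_measurable M"
    "\<And>A. A \<in> sets M \<Longrightarrow> \<psi> ` A \<in> sets borel"
proof -
  have unc: "uncountable (space M)"
    and "\<exists>T. polish_topology T \<and> topspace T = space M \<and> sets M = sets (borel_of T)"
    using assms unfolding standard_borel_space_def by simp_all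
  then obtain T where T: "polish_topology T" "topspace T = space M" "sets M = sets (borel_of T)"
    by (elim exE conjE)
  then have "completely_metrizable_space T" "separable_space T"
    unfolding polish_topology_def by simp_all
  then obtain X d where X: "Metric_space X d" "Metric_space.mcomplete X d" "T = Metric_space.mtopology X d"
    unfolding completely_metrizable_space_def by (elim exE conjE)
  interpret Metric_space X d by (rule X)
  have XM: "X = space M" using T(2) X(3) by simp
  obtain C where C: "countable C" "C \<subseteq> X" "mtopology closure_of C = X"
    using T(1) X(3) unfolding polish_topology_def separable_space_def by auto
  have "C \<noteq> {}" using C(3) unc XM by auto
  then have "C \<times> (UNIV::nat set) \<noteq> {}" "countable (C \<times> (UNIV::nat set))" using C by auto
  then obtain e :: "nat \<Rightarrow> 'a \<times> nat" where e: "range e = C \<times> (UNIV::nat set)"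
    using range_from_nat_into by (metis (no_types))
  define c r where "c = (\<lambda>n. fst (e n))" and "r = (\<lambda>n. 1 / real (Suc (snd (e n))))"
  define U where "U = (\<lambda>n. mball (c n) (r n))"
  have c: "c n \<in> X" and r: "0 < r n" for n
  proof -
    have "e n \<in> C \<times> UNIV" using e by blast
    then show "c n \<in> X" "0 < r n" using C(2) by (auto simp: c_def r_def)
  qed
  have base: "\<exists>n. x \<in> U n \<and> r n < \<epsilon>" if x: "x \<in> X" and eps: "0 < \<epsilon>" for x \<epsilon>
  proof -
    obtain k where k: "1 / real (Suc k) < \<epsilon>" using nat_approx_posE[OF eps] by blast
    have "x \<in> mtopology closure_of C" using x C(3) by simp
    then have "\<forall>r>0. \<exists>y\<in>C. y \<in> mball x r" unfolding metric_closure_of by simp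
    moreover have "0 < 1 / real (Suc k)" by simp
    ultimately obtain y where y: "y \<in> C" "y \<in> mball x (1 / real (Suc k))" by blast
    have "(y, k) \<in> range e" using e y by simp
    then obtain n where "e n = (y, k)" by (metis imageE)
    then show ?thesis using y k by (intro exI[of _ n]) (simp add: U_def c_def r_def commute)
  qed
  have U_open: "openin T (U n)" for n by (simp add: U_def X(3))
  have "{V. openin T V} \<subseteq> Pow (topspace T)" using openin_subset by blast
  then have sets_T: "sets M = sigma_sets (space M) {V. openin T V}"
    unfolding T(3) borel_of_def T(2) by (rule sets_measure_of)
  have gen: "sets M = sigma_sets (space M) (range U)"
  proof
    have "U n \<in> sets M" for n
      unfolding sets_T using U_open by blast
    then show "sigma_sets (space M) (range U) \<subseteq> sets M"
      by (auto intro!: sets.sigma_sets_subset)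
    have "V \<in> sigma_sets (space M) (range U)" if V: "openin T V" for V
    proof -
      have "\<Union>{U n | n. U n \<subseteq> V} = V"
      proof (intro equalityI subsetI)
        fix x assume x: "x \<in> V"
        have "V \<subseteq> X \<and> (\<forall>x. x \<in> V \<longrightarrow> (\<exists>r>0. mball x r \<subseteq> V))"
          using V unfolding X(3) openin_mtopology .
        with x obtain \<epsilon> where eps: "0 < \<epsilon>" "mball x \<epsilon> \<subseteq> V" and xX: "x \<in> X"
          by blast
        from base[OF xX, of "\<epsilon>/2"] eps obtain n where n: "x \<in> U n" "r n < \<epsilon>/2" by auto
        have "U n \<subseteq> mball x \<epsilon>"
        proof
          fix y assume y: "y \<in> U n"
          have "d x y \<le> d x (c n) + d (c n) y" using y xX c by (intro triangle) (auto simp: U_def)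
          then show "y \<in> mball x \<epsilon>" using n y xX by (auto simp: U_def commute)
        qed
        then show "x \<in> \<Union>{U n | n. U n \<subseteq> V}" using n eps by blast
      qed auto
      moreover have "countable {U n | n. U n \<subseteq> V}"
        by (rule countable_subset[of _ "range U"]) auto
      moreover have "{U n | n. U n \<subseteq> V} \<subseteq> sigma_sets (space M) (range U)" by auto
      ultimately show ?thesis
        using sigma_sets_UNION[of "{U n | n. U n \<subseteq> V}" "space M" "range U"] by auto
    qed
    then show "sets M \<subseteq> sigma_sets (space M) (range U)"
      unfolding sets_T by (auto intro!: sigma_sets_mono)
  qed
  define \<psi> where "\<psi> = (\<lambda>x. quaternary (\<lambda>n. x \<in> U n))"
  have digit: "quaternary_digit n (\<psi> x) \<longleftrightarrow> x \<in> U n" for n x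
    by (simp add: \<psi>_def quaternary_digit_quaternary)
  have inj: "inj_on \<psi> (space M)"
  proof (rule inj_onI, rule ccontr)
    fix x y assume xy: "x \<in> space M" "y \<in> space M" "\<psi> x = \<psi> y" "x \<noteq> y"
    then have "0 < d x y / 2" using XM by simp
    from base[OF _ this] xy XM obtain n where n: "x \<in> U n" "r n < d x y / 2" by blast
    have "y \<in> U n" using xy digit n by metis
    with n have "d x y \<le> d x (c n) + d (c n) y" by (intro triangle) (auto simp: U_def)
    with n \<open>y \<in> U n\<close> show False by (auto simp: U_def commute)
  qed
  have [measurable]: "U n \<in> sets M" for n unfolding gen by blast
  have meas: "\<psi> \<in> borel_measurable M" unfolding \<psi>_def by measurable
  \<comment> \<open>Digits can be read from every real; the first conjunct keeps only those reals
    that are the code of their digits.\<close>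
  have "\<psi> ` space M = {t. quaternary (\<lambda>n. quaternary_digit n t) = t \<and>
      (\<exists>x\<in>X. \<forall>n. quaternary_digit n t \<longleftrightarrow> x \<in> mball (c n) (r n))}"
    (is "_ = ?R")
  proof (intro equalityI subsetI)
    fix t assume "t \<in> \<psi> ` space M"
    then obtain x where x: "x \<in> X" "t = \<psi> x" using XM by blast
    have "\<forall>n. quaternary_digit n t \<longleftrightarrow> x \<in> mball (c n) (r n)"
      using digit x(2) unfolding U_def by blast
    moreover have "quaternary (\<lambda>n. quaternary_digit n t) = t"
      unfolding x(2) digit by (simp add: \<psi>_def)
    ultimately show "t \<in> ?R" using x(1) by blast
  next
    fix t assume "t \<in> ?R"
    then obtain x where x: "x \<in> X" "\<And>n. quaternary_digit n t \<longleftrightarrow> x \<in> U n"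
      and t: "quaternary (\<lambda>n. quaternary_digit n t) = t" by (auto simp: U_def)
    then have "t = \<psi> x" by (simp add: \<psi>_def)
    then show "t \<in> \<psi> ` space M" using x XM by blast
  qed
  also have "\<dots> = {t\<in>space borel. quaternary (\<lambda>n. quaternary_digit n t) = t \<and>
     (\<forall>k::nat. \<exists>n. quaternary_digit n t \<and> r n < 1 / Suc k) \<and>
     (\<forall>m n. quaternary_digit m t \<and> quaternary_digit n t \<longrightarrow>
        mball (c m) (r m) \<inter> mball (c n) (r n) \<noteq> {}) \<and>
     (\<forall>n. quaternary_digit n t \<longleftrightarrow> (\<exists>m. quaternary_digit m t \<and> d (c m) (c n) + r m < r n))}"
    by (simp only: space_borel UNIV_I simp_thms
        point_filter_iff[OF X(2) c r base[unfolded U_def], where b = "\<lambda>n. quaternary_digit n _"])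
  also have "\<dots> \<in> sets borel" by measurable
  finally have im: "\<psi> ` space M \<in> sets borel" .
  have image: "\<psi> ` A \<in> sets borel" if "A \<in> sets M" for A
  proof -
    have "A \<in> sigma_sets (space M) (range U)" using that gen by simp
    then show ?thesis
    proof induction
      case (Basic A)
      then obtain n where n: "A = U n" by blast
      have "\<psi> ` A = \<psi> ` space M \<inter> {t\<in>space borel. quaternary_digit n t}"
        using digit sets.sets_into_space[of "U n" M] by (auto simp: n)
      also have "\<dots> \<in> sets borel" using im by measurable
      finally show ?case .
    next
      case (Compl A)
      then have "A \<subseteq> space M" using gen sets.sets_into_space by blast
      then have "\<psi> ` (space M - A) = \<psi> ` space M - \<psi> ` A"
        using inj by (simp add: inj_on_image_set_diff)
      then show ?case using Compl im by simp
    next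
      case (Union A)
      then show ?case by (simp add: image_UN)
    qed simp
  qed
  from that[OF inj meas image] show ?thesis .
qed

section \<open>A measure-preserving involution\<close>

lemma emeasure_lborel_reflect:
  fixes A :: "real set"
  assumes "A \<in> sets borel"
  shows "emeasure lborel ((\<lambda>c. a - c) -` A) = emeasure lborel A"
proof -
  have "lborel = distr lborel borel (\<lambda>c. a - c)"
    using lborel_real_affine[of "-1" a] by (simp add: density_1)
  then have "emeasure lborel A = emeasure (distr lborel borel (\<lambda>c. a - c)) A" by simp
  also have "\<dots> = emeasure lborel ((\<lambda>c. a - c) -` A)"
    using assms by (subst emeasure_distr) auto
  finally show ?thesis by simp
qed

lemma (in sigma_finite_measure) exists_finite_positive_measure_set:
  assumes "emeasure M (space M) \<noteq> 0"
  obtains A where "A \<in> sets M" "0 < emeasure M A" "emeasure M A < \<infinity>"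
proof -
  obtain A :: "nat \<Rightarrow> 'a set" where A: "range A \<subseteq> sets M" "(\<Union>i. A i) = space M"
    "\<And>i. emeasure M (A i) \<noteq> \<infinity>"
    using sigma_finite by metis
  have "\<exists>i. emeasure M (A i) \<noteq> 0"
  proof (rule ccontr)
    assume "\<nexists>i. emeasure M (A i) \<noteq> 0"
    then have "emeasure M (\<Union>i. A i) = 0" using A(1) by (intro emeasure_UN_eq_0) auto
    with A(2) assms show False by simp
  qed
  then obtain i where "emeasure M (A i) \<noteq> 0" by blast
  with A that[of "A i"] show ?thesis by (auto simp: less_top[symmetric] zero_less_iff_neq_zero)
qed

text \<open>Stated for at most one point because it is applied to fibres of an injective map, which
  may be empty.\<close>

lemma atomless_singleton:
  assumes "atomless M" "S \<in> sets M" "\<And>x y. x \<in> S \<Longrightarrow> y \<in> S \<Longrightarrow> x = y"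
  shows "emeasure M S = 0"
proof (rule ccontr)
  assume "emeasure M S \<noteq> 0"
  then obtain T where T: "T \<subseteq> S" "0 < emeasure M T" "emeasure M T < emeasure M S"
    using assms(1,2) unfolding atomless_def by (metis zero_less_iff_neq_zero)
  then have "T \<noteq> {}" by auto
  with T(1) assms(3) have "T = S" by blast
  with T show False by simp
qed

text \<open>Without atoms the distribution function \<open>C\<close> is continuous, so it cannot
  jump over the value c at the quantile \<open>I c\<close>.\<close>

lemma (in cdf_distribution) cdf_quantile:
  assumes "\<And>x. measure M {x} = 0" "0 < c" "c < 1"
  shows "C (I c) = c"
proof (rule antisym)
  have "isCont C (I c)" using assms(1) by (simp add: isCont_cdf)
  then have "(C \<longlongrightarrow> C (I c)) (at_left (I c))"
    by (simp add: isCont_def filterlim_at_split)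
  moreover have "C x \<le> c" if "x < I c" for x
    using pseudoinverse[OF assms(2,3), of x] that by linarith
  then have "eventually (\<lambda>x. C x \<le> c) (at_left (I c))"
    by (auto simp: eventually_at_filter)
  ultimately show "C (I c) \<le> c"
    by (rule tendsto_upperbound) simp
  show "c \<le> C (I c)" using pseudoinverse[OF assms(2,3)] by blast
qed


text \<open>Probability integral transform: \<open>p\<close> is the distribution function of the
  embedded point under the normalised measure on \<open>B1\<close>, and in the absence of atoms it
  carries that measure to Lebesgue measure on (0,1). Shrinking \<open>B1\<close> to \<open>B\<close>
  costs a null set and makes \<open>p\<close> injective with an image symmetric about 1/2.\<close>

lemma standard_uniform_coordinate:
  fixes M :: "'a measure"
  assumes M: "standard_sigma_finite_space M"
  obtains B :: "'a set" and p :: "'a \<Rightarrow> real"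
  where "B \<in> sets M" "0 < emeasure M B" "emeasure M B < \<infinity>"
    "p \<in> borel_measurable M" "inj_on p B"
    "\<And>x. x \<in> B \<Longrightarrow> 1 - p x \<in> p ` B"
    "\<And>x. x \<in> B \<Longrightarrow> p x \<noteq> 1 / 2"
    "\<And>A. A \<in> sets M \<Longrightarrow> A \<subseteq> B \<Longrightarrow> p ` A \<in> sets borel \<and>
        emeasure M A = emeasure M B * emeasure lborel (p ` A)"
proof -
  have sb: "standard_borel_space M" and nz: "emeasure M (space M) \<noteq> 0"
    and al: "atomless M" and sf: "sigma_finite_measure M"
    using M unfolding standard_sigma_finite_space_def by simp_all
  obtain \<psi> :: "'a \<Rightarrow> real" where inj: "inj_on \<psi> (space M)"
    and [measurable]: "\<psi> \<in> borel_measurable M"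
    and image: "\<And>A. A \<in> sets M \<Longrightarrow> \<psi> ` A \<in> sets borel"
    using standard_borel_real_embedding[OF sb] by metis
  obtain B1 where B1 [measurable]: "B1 \<in> sets M" and pos: "0 < emeasure M B1"
    and fin: "emeasure M B1 < \<infinity>"
    using sigma_finite_measure.exists_finite_positive_measure_set[OF sf nz] by metis
  have B1s: "B1 \<subseteq> space M" using B1 by (rule sets.sets_into_space)
  define \<nu> where "\<nu> = distr (uniform_measure M B1) borel \<psi>"
  have "prob_space (uniform_measure M B1)"
    using pos fin by (intro prob_space_uniform_measure) auto
  then have "real_distribution \<nu>"
    unfolding \<nu>_def by (rule prob_space.real_distribution_distr) simp
  then interpret cdf_distribution \<nu> by (simp add: cdf_distribution_def)
  have sets_\<nu>: "sets \<nu> = sets borel" by (simp add: \<nu>_def)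
  have \<nu>: "emeasure \<nu> T = emeasure M (B1 \<inter> (\<psi> -` T \<inter> space M)) / emeasure M B1"
    if "T \<in> sets borel" for T
    unfolding \<nu>_def using that by (simp add: emeasure_distr)
  have atom: "measure \<nu> {t} = 0" for t
  proof -
    have "emeasure M (B1 \<inter> (\<psi> -` {t} \<inter> space M)) = 0"
      by (rule atomless_singleton[OF al]) (use inj in \<open>auto dest: inj_onD\<close>)
    then show ?thesis by (simp add: measure_def \<nu>)
  qed
  \<comment> \<open>The quantile function is known to be measurable on (0,1); the value 0 elsewhere
    makes \<open>q\<close> Borel on the whole line.\<close>
  define q where "q = (\<lambda>c. if c \<in> {0<..<1} then I c else 0)"
  have [measurable]: "q \<in> borel_measurable borel"
    unfolding q_def using measurable_CI
    by (subst (asm) measurable_restrict_space_iff[where c=0]) auto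
  have Cq: "C (q c) = c" if "0 < c" "c < 1" for c
    using cdf_quantile[OF atom that] that by (simp add: q_def)
  have \<nu>q: "emeasure \<nu> T = emeasure lborel {c\<in>{0<..<1}. q c \<in> T}" if [measurable]: "T \<in> sets borel" for T
  proof -
    have "emeasure \<nu> T = emeasure (distr (restrict_space lborel {0<..<1::real}) borel I) T"
      by (simp add: distr_I_eq_M)
    also have "\<dots> = emeasure (restrict_space lborel {0<..<1}) (I -` T \<inter> {0<..<1})"
      using measurable_CI by (subst emeasure_distr) (auto simp: space_restrict_space)
    also have "\<dots> = emeasure lborel (I -` T \<inter> {0<..<1})"
      by (subst emeasure_restrict_space) auto
    also have "I -` T \<inter> {0<..<1} = {c\<in>{0<..<1}. q c \<in> T}" by (auto simp: q_def)
    finally show ?thesis .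
  qed
  have [measurable]: "\<psi> ` B1 \<in> sets borel" using image B1 by blast
  define W where "W = {c\<in>{0<..<1}. q c \<in> \<psi> ` B1}"
  have [measurable]: "W \<in> sets borel" unfolding W_def by measurable
  have "emeasure lborel W = 1"
  proof -
    have "B1 \<inter> (\<psi> -` (\<psi> ` B1) \<inter> space M) = B1" using B1s by auto
    then show ?thesis
      using \<nu>[of "\<psi> ` B1"] \<nu>q[of "\<psi> ` B1"] pos fin by (simp add: W_def)
  qed
  have Wsub: "W \<subseteq> {0<..<1}" by (auto simp: W_def)
  have null: "emeasure lborel ({0<..<1} - W) = 0"
    using \<open>emeasure lborel W = 1\<close> Wsub by (subst emeasure_Diff) auto
  \<comment> \<open>Symmetric under c -> 1 - c, with the fixed point of the reflection removed. The
    loss is null because the reflection preserves Lebesgue measure.\<close>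
  define V where "V = {c\<in>W. 1 - c \<in> W \<and> c \<noteq> 1/2}"
  have [measurable]: "V \<in> sets borel" unfolding V_def by measurable
  have V: "emeasure lborel V = 1"
  proof -
    let ?N = "({0<..<1} - W) \<union> ((\<lambda>c. 1 - c) -` ({0<..<1} - W)) \<union> {1/2::real}"
    have "emeasure lborel ((\<lambda>c. 1 - c) -` ({0<..<1} - W)) = 0"
      using null by (subst emeasure_lborel_reflect) auto
    moreover have "(\<lambda>c::real. 1 - c) -` ({0<..<1} - W) \<in> sets borel"
      using measurable_sets[of "\<lambda>c::real. 1 - c" borel borel "{0<..<1} - W"] by simp
    ultimately have N: "?N \<in> null_sets lborel"
      using null by (intro null_sets.Un) (auto simp: null_sets_def)
    have "{0<..<1} \<subseteq> V \<union> ?N" by (auto simp: V_def)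
    then have "emeasure lborel {0<..<1::real} \<le> emeasure lborel (V \<union> ?N)"
      by (intro emeasure_mono sets.Un null_setsD2[OF N]) auto
    also have "\<dots> = emeasure lborel V" using N by (intro emeasure_Un_null_set) auto
    finally have "1 \<le> emeasure lborel V" by simp
    moreover have "emeasure lborel V \<le> emeasure lborel {0<..<1::real}"
      using Wsub by (intro emeasure_mono) (auto simp: V_def)
    ultimately show ?thesis by (simp add: antisym)
  qed
  define p where "p = (\<lambda>x. C (\<psi> x))"
  have [measurable]: "p \<in> borel_measurable M" unfolding p_def by measurable
  \<comment> \<open>The equation \<open>q (p x) = \<psi> x\<close> lets \<open>x\<close> be
    recovered from \<open>p x\<close>, also where the distribution function is flat.\<close>
  define B where "B = {x\<in>B1. p x \<in> V \<and> q (p x) = \<psi> x}"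
  have B [measurable]: "B \<in> sets M"
  proof -
    have "B = B1 \<inter> {x\<in>space M. p x \<in> V \<and> q (p x) = \<psi> x}" using B1s by (auto simp: B_def)
    also have "\<dots> \<in> sets M" by measurable
    finally show ?thesis .
  qed
  have Bs: "B \<subseteq> space M" using B1s by (auto simp: B_def)
  have injp: "inj_on p B"
  proof (rule inj_onI)
    fix x y assume "x \<in> B" "y \<in> B" "p x = p y"
    then have "\<psi> x = \<psi> y" "x \<in> space M" "y \<in> space M" using Bs by (auto simp: B_def)
    then show "x = y" using inj by (simp add: inj_on_eq_iff)
  qed
  have pB: "p ` B = V"
  proof (intro equalityI subsetI)
    fix c assume c: "c \<in> V"
    then obtain x where x: "x \<in> B1" "q c = \<psi> x" and c01: "0 < c" "c < 1" 
      by (auto simp: V_def W_def)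
    then have "p x = c" using Cq[OF c01] by (simp add: p_def)
    with x c show "c \<in> p ` B" by (auto simp: B_def intro!: image_eqI[of _ _ x])
  qed (auto simp: B_def)
  have key: "p ` A \<in> sets borel \<and> emeasure M A = emeasure M B1 * emeasure lborel (p ` A)"
    if A: "A \<in> sets M" "A \<subseteq> B" for A
  proof -
    \<comment> \<open>This turns an image under \<open>p\<close> into a preimage under the Borel
      function \<open>q\<close>, which gives both its measurability and its measure.\<close>
    have "p ` A = {c\<in>{0<..<1}. q c \<in> \<psi> ` A}"
    proof (intro equalityI subsetI)
      fix c assume "c \<in> {c\<in>{0<..<1}. q c \<in> \<psi> ` A}"
      then obtain x where "x \<in> A" "q c = \<psi> x" "0 < c" "c < 1" by auto
      then show "c \<in> p ` A" using Cq[of c] by (auto simp: p_def)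
    next
      fix c assume "c \<in> p ` A"
      then show "c \<in> {c\<in>{0<..<1}. q c \<in> \<psi> ` A}"
        using A(2) Wsub by (force simp: B_def V_def)
    qed
    moreover have [measurable]: "\<psi> ` A \<in> sets borel" using image A(1) by blast
    moreover have "B1 \<inter> (\<psi> -` (\<psi> ` A) \<inter> space M) = A"
      using A(2) B1s inj by (auto simp: B_def dest: inj_onD)
    ultimately have "emeasure lborel (p ` A) = emeasure M A / emeasure M B1"
      using \<nu>[of "\<psi> ` A"] \<nu>q[of "\<psi> ` A"] by simp
    then have "emeasure M B1 * emeasure lborel (p ` A) = emeasure M A"
      using pos fin by (simp add: ennreal_times_divide ennreal_mult_divide_eq mult.commute)
    moreover have "p ` A \<in> sets borel"
      unfolding \<open>p ` A = {c\<in>{0<..<1}. q c \<in> \<psi> ` A}\<close> by measurable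
    ultimately show ?thesis by simp
  qed
  have mB: "emeasure M B = emeasure M B1" using key[OF B] V pB by simp
  show ?thesis
  proof (rule that[of B p])
    show "1 - p x \<in> p ` B" "p x \<noteq> 1/2" if "x \<in> B" for x
    proof -
      have "p x \<in> V" using that by (simp add: B_def)
      then show "1 - p x \<in> p ` B" "p x \<noteq> 1/2" unfolding pB by (auto simp: V_def)
    qed
  qed (use B mB pos fin injp key in auto)
qed


text \<open>Forward images are controlled because the weak topology compares images; as
  \<open>f\<close> is its own inverse, they are preimages as well. Countability of \<B> allows the
  exceptional null sets to be united, and its smallness at each point makes stabilisers
  dense.\<close>

locale small_flip =
  fixes M :: "'a measure" and B :: "'a set" and f :: "'a \<Rightarrow> 'a" and \<B> :: "'a set set"
  assumes B_sets: "B \<in> sets M" and B_pos: "0 < emeasure M B" and B_fin: "emeasure M B < \<infinity>"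
    and f_f: "f (f x) = x" and f_B: "x \<in> B \<Longrightarrow> f x \<in> B" and f_neq: "x \<in> B \<Longrightarrow> f x \<noteq> x"
    and f_image: "A \<in> sets M \<Longrightarrow> A \<subseteq> B \<Longrightarrow> f ` A \<in> sets M"
    and emeasure_f_image: "A \<in> sets M \<Longrightarrow> A \<subseteq> B \<Longrightarrow> emeasure M (f ` A) = emeasure M A"
    and countable_\<B>: "countable \<B>"
    and \<B>: "b \<in> \<B> \<Longrightarrow> b \<in> sets M \<and> b \<subseteq> B \<and> f ` b \<subseteq> b"
    and \<B>_small: "x \<in> B \<Longrightarrow> 0 < \<epsilon> \<Longrightarrow> \<exists>b\<in>\<B>. x \<in> b \<and> measure M b < \<epsilon>"

text \<open>The reflection c -> 1 - c is pulled back along \<open>p\<close>. The small invariant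
  sets are preimages of a rational interval together with its mirror image.\<close>

lemma standard_small_flip:
  fixes M :: "'a measure"
  assumes M: "standard_sigma_finite_space M"
  obtains B :: "'a set" and f :: "'a \<Rightarrow> 'a" and \<B> :: "'a set set"
  where "small_flip M B f \<B>"
proof -
  obtain B and p :: "'a \<Rightarrow> real" where B [measurable]: "B \<in> sets M"
    and pos: "0 < emeasure M B" and fin: "emeasure M B < \<infinity>"
    and [measurable]: "p \<in> borel_measurable M" and inj: "inj_on p B"
    and refl: "\<And>x. x \<in> B \<Longrightarrow> 1 - p x \<in> p ` B"
    and half: "\<And>x. x \<in> B \<Longrightarrow> p x \<noteq> 1 / 2"
    and key: "\<And>A. A \<in> sets M \<Longrightarrow> A \<subseteq> B \<Longrightarrow> p ` A \<in> sets borel \<and>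
        emeasure M A = emeasure M B * emeasure lborel (p ` A)"
    using standard_uniform_coordinate[OF M] by metis
  have Bs: "B \<subseteq> space M" using B by (rule sets.sets_into_space)
  define f where "f = (\<lambda>x. if x \<in> B then inv_into B p (1 - p x) else x)"
  have fB: "f x \<in> B" and pf: "p (f x) = 1 - p x" if "x \<in> B" for x
    using refl[OF that] that by (auto simp: f_def inv_into_into f_inv_into_f)
  have ff: "f (f x) = x" for x
  proof (cases "x \<in> B")
    case True
    have "p (f (f x)) = p x" using pf fB True by simp
    then show ?thesis using inj fB True by (meson inj_onD)
  qed (simp add: f_def)
  have fne: "f x \<noteq> x" if "x \<in> B" for x
    using half[OF that] pf[OF that] by auto
  have pfA: "p ` f ` A = (\<lambda>c. 1 - c) -` (p ` A)" if "A \<subseteq> B" for A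
  proof (intro equalityI subsetI)
    fix c assume "c \<in> (\<lambda>c. 1 - c) -` (p ` A)"
    then obtain x where x: "x \<in> A" "1 - c = p x" by auto
    then have "c = p (f x)" using pf[of x] that by auto
    then show "c \<in> p ` f ` A" using x by blast
  qed (use pf that in auto)
  have fA: "f ` A = {x\<in>B. 1 - p x \<in> p ` A}" if "A \<subseteq> B" for A
  proof (intro equalityI subsetI)
    fix x assume "x \<in> {x\<in>B. 1 - p x \<in> p ` A}"
    then obtain y where y: "x \<in> B" "y \<in> A" "p (f x) = p y" using pf by auto
    then have "f x = y" using inj fB that by (meson inj_onD subsetD)
    then have "x = f y" using ff by metis
    then show "x \<in> f ` A" using y by blast
  qed (use fB pf that in auto)
  have fmeas: "f ` A \<in> sets M \<and> emeasure M (f ` A) = emeasure M A"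
    if A: "A \<in> sets M" "A \<subseteq> B" for A
  proof
    have [measurable]: "p ` A \<in> sets borel" using key[OF A] by blast
    have "f ` A = B \<inter> {x\<in>space M. 1 - p x \<in> p ` A}" using fA[OF A(2)] Bs by auto
    also have "\<dots> \<in> sets M" by measurable
    finally show meas: "f ` A \<in> sets M" .
    have "f ` A \<subseteq> B" using fB A by auto
    from key[OF meas this] key[OF A] show "emeasure M (f ` A) = emeasure M A"
      using pfA[OF A(2)] emeasure_lborel_reflect[of "p ` A" 1] by simp
  qed
  define b where "b = (\<lambda>(s, t). {x\<in>B. p x \<in> {s<..<t} \<or> 1 - p x \<in> {s<..<t}})"
  define \<B> where "\<B> = b ` (\<rat> \<times> \<rat>)"
  have bsets: "b st \<in> sets M" for st
  proof -
    obtain s t where st: "st = (s, t)" by (rule prod.exhaust)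
    have "b st = B \<inter> {x\<in>space M. p x \<in> {s<..<t} \<or> 1 - p x \<in> {s<..<t}}"
      using Bs by (auto simp: b_def st)
    also have "\<dots> \<in> sets M" by measurable
    finally show ?thesis .
  qed
  have small: "\<exists>b\<in>\<B>. x \<in> b \<and> measure M b < \<epsilon>" if x: "x \<in> B" and eps: "0 < \<epsilon>" for x \<epsilon>
  proof -
    define m where "m = measure M B"
    have m: "0 < m" using pos fin by (simp add: m_def measure_def enn2real_positive_iff)
    \<comment> \<open>\<open>s\<close> and \<open>t\<close> lie within \<delta> of
      \<open>p x\<close>, so the interval and its mirror image have total length at most 4 \<delta>;
      scaled by \<open>m\<close> this is \<epsilon>/2.\<close>
    define \<delta> where "\<delta> = \<epsilon> / (8 * m)"
    have \<delta>: "0 < \<delta>" using eps m by (simp add: \<delta>_def)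
    obtain s where s: "s \<in> \<rat>" "p x - \<delta> < s" "s < p x" using Rats_dense_in_real[of "p x - \<delta>" "p x"] \<delta> by auto
    obtain t where t: "t \<in> \<rat>" "p x < t" "t < p x + \<delta>" using Rats_dense_in_real[of "p x" "p x + \<delta>"] \<delta> by auto
    have "p ` b (s, t) \<subseteq> {s<..<t} \<union> {1-t<..<1-s}" by (auto simp: b_def)
    then have "emeasure lborel (p ` b (s, t)) \<le> emeasure lborel ({s<..<t} \<union> {1-t<..<1-s})"
      by (intro emeasure_mono) auto
    also have "\<dots> \<le> emeasure lborel {s<..<t} + emeasure lborel {1-t<..<1-s}"
      by (rule emeasure_subadditive) auto
    also have "\<dots> = ennreal (2 * (t - s))"
      using s t by (simp add: ennreal_plus[symmetric] del: ennreal_plus)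
    also have "\<dots> \<le> ennreal (4 * \<delta>)" using s t by (intro ennreal_leI) auto
    finally have "emeasure M B * emeasure lborel (p ` b (s, t)) \<le> ennreal m * ennreal (4 * \<delta>)"
      using fin by (intro mult_mono) (auto simp: m_def emeasure_eq_ennreal_measure)
    moreover have "emeasure M (b (s, t)) = emeasure M B * emeasure lborel (p ` b (s, t))"
      using key[OF bsets[of "(s, t)"]] by (auto simp: b_def)
    ultimately have "emeasure M (b (s, t)) \<le> ennreal (m * (4 * \<delta>))"
      using m \<delta> by (simp add: ennreal_mult)
    then have "measure M (b (s, t)) \<le> m * (4 * \<delta>)"
      unfolding measure_def using m \<delta> by (intro enn2real_leI) auto
    also have "\<dots> < \<epsilon>" using m eps by (simp add: \<delta>_def)
    finally have "measure M (b (s, t)) < \<epsilon>" .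
    moreover have "x \<in> b (s, t)" using x s t by (auto simp: b_def)
    ultimately show ?thesis using s t unfolding \<B>_def by blast
  qed
  have bB: "b st \<subseteq> B" for st by (auto simp: b_def split: prod.splits)
  have fb: "f ` b st \<subseteq> b st" for st
    using fB pf by (auto simp: b_def split: prod.splits)
  show ?thesis
  proof (rule that[of B f \<B>], unfold_locales)
    show "countable \<B>" unfolding \<B>_def by (intro countable_image countable_SIGMA countable_rat)
    show "c \<in> sets M \<and> c \<subseteq> B \<and> f ` c \<subseteq> c" if c: "c \<in> \<B>" for c
    proof -
      obtain st where "c = b st" using c unfolding \<B>_def by blast
      then show ?thesis using bsets bB fb by simp
    qed
    show "\<exists>c\<in>\<B>. x \<in> c \<and> measure M c < \<epsilon>" if "x \<in> B" "0 < \<epsilon>" for x \<epsilon>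
      using small that by blast
    show "f ` A \<in> sets M" "emeasure M (f ` A) = emeasure M A" if "A \<in> sets M" "A \<subseteq> B" for A
      using fmeas that by blast+
  qed (use B pos fin ff fB fne in auto)
qed

section \<open>The group of partial flips\<close>

context small_flip
begin

definition flip :: "'a set \<Rightarrow> 'a \<Rightarrow> 'a" where
  "flip A x = (if x \<in> A then f x else x)"

definition inv_sets :: "'a set set" where
  "inv_sets = {A\<in>sets M. A \<subseteq> B \<and> f ` A \<subseteq> A}"

definition sd_dist :: "'a set \<Rightarrow> 'a set \<Rightarrow> real" where
  "sd_dist A C = measure M (sym_diff A C)"

text \<open>The subgroup generated by \<B>. With exponent two no inverses are needed, and lists make
  it visibly countable.\<close>

definition gen_sets :: "'a set set" where
  "gen_sets = (\<lambda>bs. foldr (\<lambda>b C. sym_diff b C) bs {}) ` lists \<B>"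

text \<open>A closure among actual sets, not classes modulo null sets, so that the flip of a member
  is defined at every point.\<close>

definition flip_group :: "'a set set" where
  "flip_group = {A\<in>inv_sets. \<forall>\<epsilon>>0. \<exists>C\<in>gen_sets. sd_dist A C < \<epsilon>}"

lemma inv_setsD: "A \<in> inv_sets \<Longrightarrow> A \<in> sets M" "A \<in> inv_sets \<Longrightarrow> A \<subseteq> B"
  by (auto simp: inv_sets_def)

lemma f_mem_iff: "A \<in> inv_sets \<Longrightarrow> f x \<in> A \<longleftrightarrow> x \<in> A"
  unfolding inv_sets_def using f_f by (metis (no_types, lifting) image_subset_iff mem_Collect_eq)

lemma inv_setsI:
  "A \<in> sets M \<Longrightarrow> A \<subseteq> B \<Longrightarrow> (\<And>x. x \<in> A \<Longrightarrow> f x \<in> A) \<Longrightarrow> A \<in> inv_sets"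
  by (auto simp: inv_sets_def)

lemma inv_sets_sym_diff: "A \<in> inv_sets \<Longrightarrow> C \<in> inv_sets \<Longrightarrow> sym_diff A C \<in> inv_sets"
  by (rule inv_setsI) (auto simp: inv_setsD f_mem_iff dest: inv_setsD)

lemma fmeasurable_subset_B: "A \<in> sets M \<Longrightarrow> A \<subseteq> B \<Longrightarrow> A \<in> fmeasurable M"
  using fmeasurableI2[OF fmeasurableI[OF B_sets B_fin]] by blast

lemma flip_flip: "A \<in> inv_sets \<Longrightarrow> flip A (flip A x) = x"
  by (simp add: flip_def f_f f_mem_iff)

text \<open>On the intersection \<open>f\<close> acts twice and cancels; invariance of
  \<open>A\<close> keeps membership in \<open>A\<close> unchanged after the first flip.\<close>

lemma flip_sym_diff:
  "A \<in> inv_sets \<Longrightarrow> C \<in> inv_sets \<Longrightarrow> flip (sym_diff A C) x = flip A (flip C x)"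
  by (auto simp: flip_def f_f f_mem_iff)

lemma flip_image: "A \<in> inv_sets \<Longrightarrow> flip A ` Z = (Z - A) \<union> f ` (Z \<inter> A)"
  by (force simp: flip_def)

lemma flip_space: "A \<in> inv_sets \<Longrightarrow> x \<in> space M \<Longrightarrow> flip A x \<in> space M"
  using f_B sets.sets_into_space[OF B_sets] by (auto simp: flip_def dest: inv_setsD)

lemma flip_image_sets:
  assumes A: "A \<in> inv_sets" and Z: "Z \<in> sets M"
  shows "flip A ` Z \<in> sets M"
  unfolding flip_image[OF A] using A Z inv_setsD by (intro sets.Un sets.Diff f_image) auto

lemma emeasure_flip_image:
  assumes A: "A \<in> inv_sets" and Z: "Z \<in> sets M"
  shows "emeasure M (flip A ` Z) = emeasure M Z"
proof -
  have ZA: "Z \<inter> A \<in> sets M" "Z \<inter> A \<subseteq> B" using A Z inv_setsD by auto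
  have "emeasure M (flip A ` Z) = emeasure M (Z - A) + emeasure M (f ` (Z \<inter> A))"
    unfolding flip_image[OF A] using A Z ZA inv_setsD f_image f_mem_iff[OF A]
    by (intro plus_emeasure[symmetric]) auto
  also have "\<dots> = emeasure M (Z - A) + emeasure M (Z \<inter> A)"
    using emeasure_f_image[OF ZA] by simp
  also have "\<dots> = emeasure M ((Z - A) \<union> (Z \<inter> A))"
    using A Z ZA inv_setsD by (intro plus_emeasure) auto
  also have "(Z - A) \<union> (Z \<inter> A) = Z" by blast
  finally show ?thesis .
qed

lemma flip_vimage:
  assumes A: "A \<in> inv_sets" and Z: "Z \<in> sets M"
  shows "flip A -` Z \<inter> space M = flip A ` Z"
proof (intro equalityI subsetI)
  fix x assume "x \<in> flip A -` Z \<inter> space M"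
  then show "x \<in> flip A ` Z" using flip_flip[OF A, of x] by (metis IntD1 imageI vimageE)
qed (use flip_flip[OF A] flip_space[OF A] sets.sets_into_space[OF Z] in auto)

lemma mp_bijection_flip:
  assumes A: "A \<in> inv_sets"
  shows "mp_bijection M (flip A)"
  unfolding mp_bijection_def
proof (intro conjI)
  show "bij_betw (flip A) (space M) (space M)"
    by (rule bij_betw_byWitness[where f' = "flip A"]) (use flip_flip[OF A] flip_space[OF A] in auto)
  show meas: "flip A \<in> M \<rightarrow>\<^sub>M M"
    by (rule measurableI) (use flip_space[OF A] flip_vimage[OF A] flip_image_sets[OF A] in auto)
  show "distr M M (flip A) = M"
    by (rule measure_eqI)
      (auto simp: emeasure_distr[OF meas] flip_vimage[OF A] emeasure_flip_image[OF A])
qed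

lemma gen_sets_inv_sets: "A \<in> gen_sets \<Longrightarrow> A \<in> inv_sets"
proof -
  have "foldr (\<lambda>b C. sym_diff b C) bs {} \<in> inv_sets" if "set bs \<subseteq> \<B>" for bs
    using that
  proof (induction bs)
    case Nil
    then show ?case by (auto simp: inv_sets_def)
  next
    case (Cons b bs)
    then show ?case
      using inv_sets_sym_diff[of b "foldr (\<lambda>b C. sym_diff b C) bs {}"] \<B> by (auto simp: inv_sets_def)
  qed
  then show "A \<in> gen_sets \<Longrightarrow> A \<in> inv_sets" by (auto simp: gen_sets_def)
qed

lemma countable_gen_sets: "countable gen_sets"
  unfolding gen_sets_def using countable_\<B> by (intro countable_image countable_lists)

lemma gen_sets_sym_diff:
  assumes "A \<in> gen_sets" "C \<in> gen_sets"
  shows "sym_diff A C \<in> gen_sets"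
proof -
  obtain as cs where as: "as \<in> lists \<B>" "A = foldr (\<lambda>b C. sym_diff b C) as {}"
    and cs: "cs \<in> lists \<B>" "C = foldr (\<lambda>b C. sym_diff b C) cs {}"
    using assms unfolding gen_sets_def by blast
  have "foldr (\<lambda>b C. sym_diff b C) as C = sym_diff (foldr (\<lambda>b C. sym_diff b C) as {}) C"
    by (induction as) auto
  then have "sym_diff A C = foldr (\<lambda>b C. sym_diff b C) (as @ cs) {}" by (simp add: as(2) cs(2))
  moreover have "as @ cs \<in> lists \<B>" using as cs by simp
  ultimately show ?thesis unfolding gen_sets_def by blast
qed

lemma \<B>_gen_sets: "b \<in> \<B> \<Longrightarrow> b \<in> gen_sets"
  unfolding gen_sets_def by (rule image_eqI[of _ _ "[b]"]) auto

lemma sd_dist_triangle: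
  assumes "A \<in> inv_sets" "C \<in> inv_sets" "E \<in> inv_sets"
  shows "sd_dist A E \<le> sd_dist A C + sd_dist C E"
proof -
  have fm: "sym_diff A C \<in> fmeasurable M" "sym_diff C E \<in> fmeasurable M" "sym_diff A E \<in> sets M"
    using assms inv_sets_sym_diff inv_setsD by (auto intro!: fmeasurable_subset_B dest: inv_setsD)
  have "sd_dist A E \<le> measure M (sym_diff A C \<union> sym_diff C E)"
    unfolding sd_dist_def using fm by (intro measure_mono_fmeasurable) auto
  also have "\<dots> \<le> sd_dist A C + sd_dist C E"
    unfolding sd_dist_def using fm by (intro measure_Un_le) auto
  finally show ?thesis .
qed

lemma sd_dist_commute: "sd_dist A C = sd_dist C A"
  by (simp add: sd_dist_def Un_commute)

text \<open>The pointwise lower limit \<open>L\<close> is invariant exactly, not just almost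
  everywhere. A point in none of the consecutive differences from n on has constant membership from
  n on, so the distance to \<open>L\<close> is at most the geometric tail
  \<open>2 * (1/2) ^ n\<close>.\<close>

lemma sd_dist_limit:
  assumes A: "\<And>n. A n \<in> inv_sets" and d: "\<And>n. sd_dist (A n) (A (Suc n)) \<le> (1/2) ^ n"
  shows "\<exists>L\<in>inv_sets. (\<lambda>n. sd_dist (A n) L) \<longlonglongrightarrow> 0"
proof
  define L where "L = (\<Union>n. \<Inter>k\<in>{n..}. A k)"
  have As: "A n \<in> sets M" "A n \<subseteq> B" for n using A inv_setsD by auto
  show L: "L \<in> inv_sets"
  proof (rule inv_setsI)
    show "L \<in> sets M" unfolding L_def using As by (intro sets.countable_UN' sets.countable_INT') auto
    show "L \<subseteq> B" unfolding L_def using As(2) by fastforce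
    show "f x \<in> L" if "x \<in> L" for x using that f_mem_iff[OF A] by (auto simp: L_def)
  qed
  have bound: "sd_dist (A n) L \<le> 2 * (1/2) ^ n" for n
  proof -
    let ?E = "\<lambda>k. sym_diff (A (n + k)) (A (Suc (n + k)))"
    have Es: "?E k \<in> sets M" "?E k \<subseteq> B" for k using As by auto
    have sub: "sym_diff (A n) L \<subseteq> (\<Union>k. ?E k)"
    proof (rule ccontr)
      assume "\<not> ?thesis"
      then obtain x where x: "x \<in> sym_diff (A n) L" and nE: "\<And>k. x \<notin> ?E k" by blast
      have const: "x \<in> A (n + k) \<longleftrightarrow> x \<in> A n" for k
        using nE by (induction k) auto
      have "x \<in> L \<longleftrightarrow> x \<in> A n"
      proof
        assume "x \<in> L"
        then obtain m where m: "\<And>k. k \<ge> m \<Longrightarrow> x \<in> A k" by (auto simp: L_def)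
        show "x \<in> A n" using m[of "n + m"] const[of m] by simp
      next
        assume "x \<in> A n"
        then have "x \<in> A k" if "k \<ge> n" for k using const[of "k - n"] that by simp
        then show "x \<in> L" by (auto simp: L_def)
      qed
      with x show False by blast
    qed
    have "emeasure M (sym_diff (A n) L) \<le> emeasure M (\<Union>k. ?E k)"
      using Es sub by (intro emeasure_mono) auto
    also have "\<dots> \<le> (\<Sum>k. emeasure M (?E k))"
      using Es by (intro emeasure_subadditive_countably) auto
    also have "\<dots> \<le> (\<Sum>k. ennreal ((1/2) ^ n * (1/2) ^ k))"
    proof (rule suminf_le)
      fix k
      have "?E k \<in> fmeasurable M" using Es by (intro fmeasurable_subset_B)
      then have "emeasure M (?E k) = ennreal (sd_dist (A (n + k)) (A (Suc (n + k))))"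
        by (simp add: sd_dist_def emeasure_eq_measure2)
      also have "\<dots> \<le> ennreal ((1/2) ^ n * (1/2) ^ k)"
        using d[of "n + k"] by (intro ennreal_leI) (simp add: power_add)
      finally show "emeasure M (?E k) \<le> ennreal ((1/2) ^ n * (1/2) ^ k)" .
    qed auto
    also have "\<dots> = ennreal (\<Sum>k. (1/2) ^ n * (1/2) ^ k)"
      by (rule suminf_ennreal2) (auto intro!: summable_mult)
    also have "(\<Sum>k. (1/2) ^ n * (1/2::real) ^ k) = 2 * (1/2) ^ n"
      by (subst suminf_mult) (auto simp: suminf_geometric)
    finally show ?thesis
      unfolding sd_dist_def measure_def by (intro enn2real_leI) auto
  qed
  have "(\<lambda>n. 2 * (1/2::real) ^ n) \<longlonglongrightarrow> 0"
    by (intro tendsto_mult_right_zero LIMSEQ_realpow_zero) auto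
  then show "(\<lambda>n. sd_dist (A n) L) \<longlonglongrightarrow> 0"
    by (rule Lim_null_comparison[rotated])
      (use bound in \<open>auto simp: sd_dist_def\<close>)
qed

lemma flip_group_inv_sets: "A \<in> flip_group \<Longrightarrow> A \<in> inv_sets"
  by (simp add: flip_group_def)

lemma gen_sets_flip_group: "A \<in> gen_sets \<Longrightarrow> A \<in> flip_group"
  unfolding flip_group_def using gen_sets_inv_sets
  by (auto simp: sd_dist_def intro!: bexI[of _ A])

sublocale complete_pseudometric_group flip_group sd_dist "\<lambda>A C. sym_diff A C"
proof
  show "sd_dist A A = 0" for A by (simp add: sd_dist_def)
  show "sd_dist A C = sd_dist C A" for A C by (rule sd_dist_commute)
  show "sd_dist A E \<le> sd_dist A C + sd_dist C E"
    if "A \<in> flip_group" "C \<in> flip_group" "E \<in> flip_group" for A C E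
    using that flip_group_inv_sets by (intro sd_dist_triangle) auto
  show "\<exists>L\<in>flip_group. (\<lambda>n. sd_dist (A n) L) \<longlonglongrightarrow> 0"
    if A: "\<And>n. A n \<in> flip_group" and d: "\<And>n. sd_dist (A n) (A (Suc n)) \<le> (1/2) ^ n" for A
  proof -
    obtain L where L: "L \<in> inv_sets" "(\<lambda>n. sd_dist (A n) L) \<longlonglongrightarrow> 0"
      using sd_dist_limit[of A] A d flip_group_inv_sets by blast
    have "\<exists>C\<in>gen_sets. sd_dist L C < \<epsilon>" if eps: "0 < \<epsilon>" for \<epsilon>
    proof -
      have "eventually (\<lambda>n. sd_dist (A n) L < \<epsilon>/2) sequentially"
        using L(2) eps by (intro order_tendstoD) auto
      then obtain n where n: "sd_dist (A n) L < \<epsilon>/2"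
        by (auto simp: eventually_sequentially)
      obtain C where C: "C \<in> gen_sets" "sd_dist (A n) C < \<epsilon>/2"
        using A[of n] eps unfolding flip_group_def by (auto dest!: spec[of _ "\<epsilon>/2"])
      have "sd_dist L C \<le> sd_dist L (A n) + sd_dist (A n) C"
        using L A C flip_group_inv_sets gen_sets_inv_sets by (intro sd_dist_triangle) auto
      with n C sd_dist_commute[of L "A n"] show ?thesis by (intro bexI[of _ C]) auto
    qed
    with L show ?thesis by (auto simp: flip_group_def)
  qed
  show "sym_diff A C \<in> flip_group" if A: "A \<in> flip_group" and C: "C \<in> flip_group" for A C
  proof -
    have "\<exists>E\<in>gen_sets. sd_dist (sym_diff A C) E < \<epsilon>" if eps: "0 < \<epsilon>" for \<epsilon>
    proof -
      obtain A' where A': "A' \<in> gen_sets" "sd_dist A A' < \<epsilon>/2"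
        using A eps unfolding flip_group_def by (auto dest!: spec[of _ "\<epsilon>/2"])
      obtain C' where C': "C' \<in> gen_sets" "sd_dist C C' < \<epsilon>/2"
        using C eps unfolding flip_group_def by (auto dest!: spec[of _ "\<epsilon>/2"])
      have "sd_dist (sym_diff A C) (sym_diff A' C')
          \<le> sd_dist (sym_diff A C) (sym_diff A' C) + sd_dist (sym_diff A' C) (sym_diff A' C')"
        using A C A' C' flip_group_inv_sets gen_sets_inv_sets inv_sets_sym_diff
        by (intro sd_dist_triangle) auto
      also have "sd_dist (sym_diff A C) (sym_diff A' C) = sd_dist A A'"
        unfolding sd_dist_def by (rule arg_cong[of _ _ "measure M"]) blast
      also have "sd_dist (sym_diff A' C) (sym_diff A' C') = sd_dist C C'"
        unfolding sd_dist_def by (rule arg_cong[of _ _ "measure M"]) blast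
      finally show ?thesis
        using A' C' gen_sets_sym_diff by (intro bexI[of _ "sym_diff A' C'"]) auto
    qed
    then show ?thesis
      using inv_sets_sym_diff A C flip_group_inv_sets unfolding flip_group_def by blast
  qed
  show "sym_diff (sym_diff A C) C = A" for A C :: "'a set" by blast
  show "sym_diff A C = sym_diff C A" for A C :: "'a set" by blast
  show "sd_dist (sym_diff A E) (sym_diff C E) = sd_dist A C" for A C E
    unfolding sd_dist_def by (rule arg_cong[of _ _ "measure M"]) blast
qed

end

section \<open>Product and underlying set of the group of classes of measure-preserving
  bijections\<close>

lemma mp_bijection_comp:
  assumes "mp_bijection M S" "mp_bijection M T"
  shows "mp_bijection M (S \<circ> T)"
  using assms unfolding mp_bijection_def
  by (metis bij_betw_trans measurable_comp distr_distr)

lemma AE_mp_bijection: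
  assumes "mp_bijection M T" "AE x in M. P x"
  shows "AE x in M. P (T x)"
  using assms unfolding mp_bijection_def by (metis AE_distrD)

lemma equiv_ae_eq_rel: "equiv {T. mp_bijection M T} (ae_eq_rel M)"
proof (rule equivI)
  show "ae_eq_rel M \<subseteq> {T. mp_bijection M T} \<times> {T. mp_bijection M T}"
    by (auto simp: ae_eq_rel_def)
  show "refl_on {T. mp_bijection M T} (ae_eq_rel M)"
    by (auto simp: ae_eq_rel_def refl_on_def)
  show "sym (ae_eq_rel M)"
    by (rule symI) (auto simp: ae_eq_rel_def elim: eventually_mono)
  show "trans (ae_eq_rel M)"
    by (rule transI) (auto simp: ae_eq_rel_def elim: eventually_elim2)
qed

text \<open>The union defining the product is over one and the same class: replacing
  \<open>S\<close> by \<open>S'\<close> under \<open>T\<close> changes the composite on a null set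
  only, since \<open>T\<close> preserves the measure.\<close>

lemma aut_group_mult_classes:
  assumes S: "mp_bijection M S" and T: "mp_bijection M T"
  shows "ae_eq_rel M `` {S} \<otimes>\<^bsub>aut_group M\<^esub> ae_eq_rel M `` {T} = ae_eq_rel M `` {S \<circ> T}"
proof -
  have cls: "ae_eq_rel M `` {S' \<circ> T'} = ae_eq_rel M `` {S \<circ> T}"
    if S': "(S, S') \<in> ae_eq_rel M" and T': "(T, T') \<in> ae_eq_rel M" for S' T'
  proof -
    have mp: "mp_bijection M S'" "mp_bijection M T'"
      and ae: "AE x in M. S x = S' x" "AE x in M. T x = T' x"
      using S' T' by (auto simp: ae_eq_rel_def)
    have "AE x in M. S (T x) = S' (T x)" by (rule AE_mp_bijection[OF T ae(1)])
    with ae(2) have "AE x in M. (S \<circ> T) x = (S' \<circ> T') x" by eventually_elim simp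
    then have "(S \<circ> T, S' \<circ> T') \<in> ae_eq_rel M"
      using S T mp by (simp add: ae_eq_rel_def mp_bijection_comp)
    then show ?thesis by (rule equiv_class_eq[OF equiv_ae_eq_rel, symmetric])
  qed
  have "(\<Union>S'\<in>ae_eq_rel M `` {S}. \<Union>T'\<in>ae_eq_rel M `` {T}. ae_eq_rel M `` {S' \<circ> T'}) =
      (\<Union>S'\<in>ae_eq_rel M `` {S}. \<Union>T'\<in>ae_eq_rel M `` {T}. ae_eq_rel M `` {S \<circ> T})"
    by (intro SUP_cong refl cls) simp_all
  moreover have "S \<in> ae_eq_rel M `` {S}" "T \<in> ae_eq_rel M `` {T}"
    using S T by (simp_all add: ae_eq_rel_def)
  then have "ae_eq_rel M `` {S} \<noteq> {}" "ae_eq_rel M `` {T} \<noteq> {}" by blast+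
  ultimately show ?thesis
    unfolding aut_group_def by (simp del: Image_singleton_iff)
qed

lemma topspace_weak_topology: "topspace (weak_topology M) = carrier (aut_group M)"
proof -
  let ?S = "{{c \<in> carrier (aut_group M). \<exists>S\<in>c. emeasure M (sym_diff (S ` A) (T ` A)) < ennreal \<epsilon>} | T A \<epsilon>.
        mp_bijection M T \<and> A \<in> sets M \<and> emeasure M A < \<infinity> \<and> \<epsilon> > 0}"
  have "carrier (aut_group M) \<subseteq> \<Union>?S"
  proof
    fix c assume c: "c \<in> carrier (aut_group M)"
    then obtain T where T: "mp_bijection M T" "c = ae_eq_rel M `` {T}"
      by (auto simp: aut_group_def elim: quotientE)
    then have "T \<in> c" by (simp add: ae_eq_rel_def)
    \<comment> \<open>Tested on the empty set every distance is 0, so each class lies in some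
      subbasic set.\<close>
    then have "\<exists>S\<in>c. emeasure M (sym_diff (S ` {}) (T ` {})) < ennreal 1"
      by (intro bexI[of _ T]) simp_all
    with c have "c \<in> {c \<in> carrier (aut_group M). \<exists>S\<in>c. emeasure M (sym_diff (S ` {}) (T ` {})) < ennreal 1}"
      by (intro CollectI conjI)
    moreover have "\<dots> \<in> ?S" using T(1)
      by (intro CollectI exI[of _ T] exI[of _ "{}"] exI[of _ 1]) simp
    ultimately show "c \<in> \<Union>?S" by (rule UnionI[rotated])
  qed
  moreover have "\<Union>?S \<subseteq> carrier (aut_group M)" by blast
  ultimately show ?thesis
    unfolding weak_topology_def topology_generated_by_topspace by (rule antisym[rotated])
qed

section \<open>Continuity of the homomorphism from sets to classes of flips, and density of
  stabilisers\<close>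

context small_flip
begin

definition flip_class :: "'a set \<Rightarrow> ('a \<Rightarrow> 'a) set" where
  "flip_class A = ae_eq_rel M `` {flip A}"

lemma flip_mem_flip_class: "A \<in> inv_sets \<Longrightarrow> flip A \<in> flip_class A"
  by (simp add: flip_class_def ae_eq_rel_def mp_bijection_flip)

lemma flip_class_carrier: "A \<in> inv_sets \<Longrightarrow> flip_class A \<in> carrier (aut_group M)"
  unfolding flip_class_def aut_group_def by (simp add: quotientI mp_bijection_flip)

lemma flip_class_empty: "flip_class {} = \<one>\<^bsub>aut_group M\<^esub>"
proof -
  have "flip {} = id" by (auto simp: flip_def)
  then show ?thesis by (simp add: flip_class_def aut_group_def)
qed

lemma flip_class_sym_diff:
  assumes "A \<in> inv_sets" "C \<in> inv_sets"
  shows "flip_class (sym_diff A C) = flip_class A \<otimes>\<^bsub>aut_group M\<^esub> flip_class C"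
proof -
  have "flip (sym_diff A C) = flip A \<circ> flip C"
    using flip_sym_diff[OF assms] by auto
  then show ?thesis
    unfolding flip_class_def using assms by (simp add: aut_group_mult_classes mp_bijection_flip)
qed

text \<open>Subbasic sets ask for some representative \<open>S\<close>, about which little is known.
  Composing that very \<open>S\<close> with an explicit flip gives a representative of the nearby
  class whose images are comparable with those of \<open>S\<close>.\<close>

lemma flip_class_translate:
  assumes A: "A \<in> inv_sets" and C: "C \<in> inv_sets" and S: "S \<in> flip_class A"
  shows "flip (sym_diff A C) \<circ> S \<in> flip_class C"
proof -
  have mp: "mp_bijection M S" and ae: "AE x in M. flip A x = S x"
    using S by (auto simp: flip_class_def ae_eq_rel_def)
  let ?E = "sym_diff A C"
  have E: "?E \<in> inv_sets" by (rule inv_sets_sym_diff[OF A C])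
  have "flip C x = flip ?E (flip A x)" for x
  proof -
    have "sym_diff ?E A = C" by blast
    with flip_sym_diff[OF E A, of x] show ?thesis by (simp only:)
  qed
  with ae have "AE x in M. flip C x = (flip ?E \<circ> S) x" by auto
  then show ?thesis
    using mp_bijection_flip[OF C] mp_bijection_comp[OF mp_bijection_flip[OF E] mp]
    by (simp add: flip_class_def ae_eq_rel_def)
qed

text \<open>
  Images under elements of a class need not be known to be measurable (this would be the
  Lusin--Souslin theorem). If one of the two sets compared is not measurable, the value of
  \<open>emeasure\<close> is \<open>0\<close>, and composing with a flip, which maps measurable
  sets to measurable sets in both directions, preserves this case.
\<close>

lemma popen_weak_subbasic:
  assumes Z: "Z \<in> sets M"
  shows "popen {A\<in>flip_group. \<exists>S\<in>flip_class A. emeasure M (sym_diff (S ` Z) W) < ennreal \<epsilon>}"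
    (is "popen ?P")
  unfolding popen_def
proof (intro conjI ballI)
  fix A assume "A \<in> ?P"
  then obtain S where A: "A \<in> inv_sets" and S: "S \<in> flip_class A"
    and lt: "emeasure M (sym_diff (S ` Z) W) < ennreal \<epsilon>"
    using flip_group_inv_sets by blast
  have pos: "0 < ennreal \<epsilon>" using lt by (rule le_less_trans[rotated]) simp
  obtain s where s: "emeasure M (sym_diff (S ` Z) W) = ennreal s" "0 \<le> s" "s < \<epsilon>"
    using lt by (cases "emeasure M (sym_diff (S ` Z) W)" rule: ennreal_cases) (auto simp: ennreal_less_iff)
  have "pball A (\<epsilon> - s) \<subseteq> ?P"
  proof
    fix C assume "C \<in> pball A (\<epsilon> - s)"
    then have Cg: "C \<in> flip_group" and C: "C \<in> inv_sets" and dist: "sd_dist A C < \<epsilon> - s"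
      using flip_group_inv_sets by (auto simp: pball_def)
    let ?E = "sym_diff A C"
    have E: "?E \<in> inv_sets" by (rule inv_sets_sym_diff[OF A C])
    let ?S = "flip ?E \<circ> S"
    have S': "?S \<in> flip_class C" by (rule flip_class_translate[OF A C S])
    have im: "?S ` Z = flip ?E ` (S ` Z)" by (simp add: image_comp)
    have iff: "?S ` Z \<in> sets M \<longleftrightarrow> S ` Z \<in> sets M"
    proof
      assume "?S ` Z \<in> sets M"
      then have "flip ?E ` flip ?E ` (S ` Z) \<in> sets M" unfolding im by (rule flip_image_sets[OF E])
      also have "flip ?E ` flip ?E ` (S ` Z) = S ` Z" by (simp add: image_image flip_flip[OF E])
      finally show "S ` Z \<in> sets M" .
    qed (unfold im, rule flip_image_sets[OF E])
    have nonmeas: "emeasure M (sym_diff X Y) < ennreal \<epsilon>"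
      if "X \<in> sets M \<longleftrightarrow> Y \<notin> sets M" for X Y
    proof -
      have "sym_diff X Y \<notin> sets M"
      proof
        assume m: "sym_diff X Y \<in> sets M"
        have sd: "sym_diff Q P \<in> sets M" if "Q \<in> sets M" "P \<in> sets M" for P Q
          using that by (intro sets.Un sets.Diff)
        have "sym_diff (sym_diff X Y) Y = X" "sym_diff (sym_diff X Y) X = Y" by blast+
        with sd[OF m, of X] sd[OF m, of Y] that show False by metis
      qed
      then show ?thesis using pos by (simp add: emeasure_notin_sets)
    qed
    have "\<exists>R\<in>flip_class C. emeasure M (sym_diff (R ` Z) W) < ennreal \<epsilon>"
    proof (cases "S ` Z \<in> sets M \<longleftrightarrow> W \<in> sets M")
      case False
      then show ?thesis using nonmeas[of "?S ` Z" W] iff S' by blast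
    next
      case same: True
      show ?thesis
      proof (cases "W \<in> sets M")
        \<comment> \<open>Here \<open>S\<close> is abandoned: \<open>flip C\<close> maps
          \<open>Z\<close> to a measurable set while \<open>W\<close> is not measurable, so the
          symmetric difference has \<open>emeasure\<close> 0 by default.\<close>
        case False
        then show ?thesis
          using nonmeas[of "flip C ` Z" W] flip_image_sets[OF C Z] flip_mem_flip_class[OF C] by blast
      next
        case True
        then have SZ: "S ` Z \<in> sets M" using same by blast
        \<comment> \<open>The flip moves points only within the invariant set \<open>?E\<close>, so
          the image changes by at most \<open>?E\<close>, whose measure is
          \<open>sd_dist A C\<close>.\<close>
        have "sym_diff (?S ` Z) W \<subseteq> sym_diff (S ` Z) W \<union> ?E"
          unfolding im flip_image[OF E] using f_mem_iff[OF E] by blast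
        then have "emeasure M (sym_diff (?S ` Z) W) \<le> emeasure M (sym_diff (S ` Z) W \<union> ?E)"
          using SZ True inv_setsD(1)[OF E] by (intro emeasure_mono) auto
        also have "\<dots> \<le> emeasure M (sym_diff (S ` Z) W) + emeasure M ?E"
          using SZ True inv_setsD(1)[OF E] by (intro emeasure_subadditive) auto
        also have "emeasure M ?E = ennreal (sd_dist A C)"
          unfolding sd_dist_def
          by (rule emeasure_eq_measure2[OF fmeasurable_subset_B[OF inv_setsD[OF E]]])
        also have "emeasure M (sym_diff (S ` Z) W) + ennreal (sd_dist A C) = ennreal (s + sd_dist A C)"
          using s(2) by (simp add: s(1) sd_dist_def)
        also have "\<dots> < ennreal \<epsilon>" using dist s by (intro ennreal_lessI) auto
        finally show ?thesis using S' by blast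
      qed
    qed
    with Cg show "C \<in> ?P" by blast
  qed
  with s(3) show "\<exists>r>0. pball A r \<subseteq> ?P" by (intro exI[of _ "\<epsilon> - s"]) simp
qed auto

lemma popen_flip_class:
  assumes "openin (weak_topology M) V"
  shows "popen {A\<in>flip_group. flip_class A \<in> V}"
proof -
  from assms show ?thesis
    unfolding weak_topology_def openin_topology_generated_by_iff
  proof induction
    case Empty
    then show ?case by (simp add: popen_def)
  next
    case (Int U V)
    have "{A\<in>flip_group. flip_class A \<in> U \<inter> V} =
        {A\<in>flip_group. flip_class A \<in> U} \<inter> {A\<in>flip_group. flip_class A \<in> V}" by blast
    with Int popen_Int show ?case by simp
  next
    case (UN K)
    have "{A\<in>flip_group. flip_class A \<in> \<Union>K} = \<Union>((\<lambda>U. {A\<in>flip_group. flip_class A \<in> U}) ` K)"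
      by blast
    then show ?case using UN by (auto intro!: popen_Union)
  next
    case (Basis U)
    then obtain T Z \<epsilon> where U: "U = {c \<in> carrier (aut_group M). \<exists>S\<in>c. emeasure M (sym_diff (S ` Z) (T ` Z)) < ennreal \<epsilon>}"
      and Z: "Z \<in> sets M" by blast
    have "{A\<in>flip_group. flip_class A \<in> U} =
        {A\<in>flip_group. \<exists>S\<in>flip_class A. emeasure M (sym_diff (S ` Z) (T ` Z)) < ennreal \<epsilon>}"
      using flip_class_carrier flip_group_inv_sets by (auto simp: U)
    then show ?case using popen_weak_subbasic[OF Z] by simp
  qed
qed

text \<open>Borel sets pull back along the continuous homomorphism into the sets with the Baire
  property, which are closed under complements and countable unions.\<close>

lemma baire_property_flip_class:
  assumes "V \<in> sets (borel_of (weak_topology M))"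
  shows "baire_property {A\<in>flip_group. flip_class A \<in> V}"
proof -
  have "{U. openin (weak_topology M) U} \<subseteq> Pow (topspace (weak_topology M))"
    using openin_subset by blast
  with assms have "V \<in> sigma_sets (topspace (weak_topology M)) {U. openin (weak_topology M) U}"
    unfolding borel_of_def by simp
  then show ?thesis
  proof induction
    case (Basic U)
    then show ?case by (simp add: baire_property_popen popen_flip_class)
  next
    case Empty
    then show ?case using baire_property_popen[of "{}"] by (simp add: popen_def)
  next
    case (Compl U)
    have "{A\<in>flip_group. flip_class A \<in> topspace (weak_topology M) - U} =
        flip_group - {A\<in>flip_group. flip_class A \<in> U}"
      using flip_class_carrier flip_group_inv_sets by (auto simp: topspace_weak_topology)
    with baire_property_Diff[OF Compl.IH] show ?case by simp
  next
    case (Union U)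
    have "{A\<in>flip_group. flip_class A \<in> (\<Union>i. U i)} = (\<Union>i. {A\<in>flip_group. flip_class A \<in> U i})"
      by blast
    with baire_property_UN[OF Union.IH] show ?case by simp
  qed
qed

text \<open>Whether \<open>flip C\<close> moves \<open>x\<close> depends only on whether
  \<open>x\<close> lies in \<open>C\<close>, and adding a small \<open>b\<close> around
  \<open>x\<close> takes \<open>x\<close> out. The witness stays in \<open>gen_sets\<close>, where
  equivariance at a fixed generic point will be available.\<close>

lemma stabiliser_dense:
  assumes x: "x \<in> B" and A: "A \<in> flip_group" and r: "0 < r"
  shows "\<exists>C\<in>gen_sets. flip C x = x \<and> C \<in> pball A r"
proof -
  obtain C where C: "C \<in> gen_sets" "sd_dist A C < r/2"
    using A r unfolding flip_group_def by (auto dest!: spec[of _ "r/2"])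
  show ?thesis
  proof (cases "x \<in> C")
    case False
    then show ?thesis using C r gen_sets_flip_group by (auto simp: flip_def pball_def intro!: bexI[of _ C])
  next
    case True
    obtain b where b: "b \<in> \<B>" "x \<in> b" "measure M b < r/2" using \<B>_small[OF x, of "r/2"] r by auto
    let ?C = "sym_diff b C"
    have g: "?C \<in> gen_sets" using gen_sets_sym_diff \<B>_gen_sets b C by blast
    have "sd_dist A ?C \<le> sd_dist A C + sd_dist C ?C"
      using A C g gen_sets_inv_sets flip_group_inv_sets by (intro sd_dist_triangle) auto
    also have "sd_dist C ?C = measure M b"
      unfolding sd_dist_def by (rule arg_cong[of _ _ "measure M"]) blast
    finally have "?C \<in> pball A r" using b C g gen_sets_flip_group by (auto simp: pball_def)
    moreover have "flip ?C x = x" using True b by (simp add: flip_def)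
    ultimately show ?thesis using g by blast
  qed
qed

end

section \<open>Spatial models\<close>

text \<open>Preimages of rational half-lines under the embedding. They reduce equality of two points
  to countably many Borel questions, one application of the zero-one law for each.\<close>

lemma standard_borel_separating_sequence:
  fixes N :: "'b measure"
  assumes "standard_borel_space N"
  obtains A :: "nat \<Rightarrow> 'b set" where "\<And>n. A n \<in> sets N"
    "\<And>z w. z \<in> space N \<Longrightarrow> w \<in> space N \<Longrightarrow> (\<And>n. z \<in> A n \<longleftrightarrow> w \<in> A n) \<Longrightarrow> z = w"
proof -
  obtain \<psi> :: "'b \<Rightarrow> real" where inj: "inj_on \<psi> (space N)"
    and [measurable]: "\<psi> \<in> borel_measurable N"
    using standard_borel_real_embedding[OF assms] by metis
  define r :: "nat \<Rightarrow> real" where "r = from_nat_into \<rat>"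
  have r: "range r = \<rat>"
    unfolding r_def by (rule range_from_nat_into) (auto simp: countable_rat)
  have le: "\<psi> w \<le> \<psi> z"
    if "z \<in> space N" "w \<in> space N" "\<And>n. \<psi> z < r n \<longleftrightarrow> \<psi> w < r n" for z w
  proof (rule ccontr)
    assume "\<not> \<psi> w \<le> \<psi> z"
    then obtain s where "s \<in> \<rat>" "\<psi> z < s" "s < \<psi> w" using Rats_dense_in_real[of "\<psi> z" "\<psi> w"] by auto
    then show False using r that(3) by (metis imageE less_asym)
  qed
  show ?thesis
  proof (rule that[of "\<lambda>n. {z\<in>space N. \<psi> z < r n}"])
    show "{z\<in>space N. \<psi> z < r n} \<in> sets N" for n by measurable
    fix z w assume zw: "z \<in> space N" "w \<in> space N"
      and "\<And>n. z \<in> {z\<in>space N. \<psi> z < r n} \<longleftrightarrow> w \<in> {z\<in>space N. \<psi> z < r n}"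
    then have "\<psi> z = \<psi> w" using le[of z w] le[of w z] by (simp add: antisym)
    with inj zw show "z = w" by (meson inj_onD)
  qed
qed

theorem proposition7p4:
  fixes M :: "'a measure" and \<alpha> :: "('a \<Rightarrow> 'a) set \<times> 'a \<Rightarrow> 'a"
  assumes "standard_sigma_finite_space M"
    and "natural_boolean_action M \<alpha>"
  shows "\<not> admits_spatial_model TYPE('b) (aut_group M) (weak_topology M) M \<alpha>"
proof
  assume "admits_spatial_model TYPE('b) (aut_group M) (weak_topology M) M \<alpha>"
  then obtain N :: "'b measure" and \<beta> where N: "standard_sigma_finite_space N"
    and spatial: "spatial_action (aut_group M) (weak_topology M) N \<beta>"
    and iso: "booleanly_isomorphic (aut_group M) M \<alpha> N \<beta>"
    unfolding admits_spatial_model_def by (elim exE conjE)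
  obtain B f \<B> where flip: "small_flip M B f \<B>"
    using standard_small_flip[OF assms(1)] by blast
  interpret small_flip M B f \<B> by (rule flip)

  obtain X\<^sub>0 \<Phi> where X0: "X\<^sub>0 \<in> sets M" and \<Phi>: "\<Phi> \<in> restrict_space M X\<^sub>0 \<rightarrow>\<^sub>M N" and inj: "inj_on \<Phi> X\<^sub>0"
    and eqv: "\<And>g. g \<in> carrier (aut_group M) \<Longrightarrow> \<exists>X\<^sub>g\<in>sets M. X\<^sub>g \<subseteq> X\<^sub>0 \<and> space M - X\<^sub>g \<in> null_sets M \<and>
           (\<forall>x\<in>X\<^sub>g. \<alpha> (g, x) \<in> X\<^sub>0 \<and> \<Phi> (\<alpha> (g, x)) = \<beta> (g, \<Phi> x))"
    using iso unfolding booleanly_isomorphic_def by metis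

  \<comment> \<open>Naturality makes \<alpha> agree almost everywhere with the explicit flip, so
    \<alpha> disappears here.\<close>
  have equivariant: "AE x in M. x \<in> X\<^sub>0 \<and> flip A x \<in> X\<^sub>0 \<and> \<Phi> (flip A x) = \<beta> (flip_class A, \<Phi> x)"
    if A: "A \<in> inv_sets" for A
  proof -
    have g: "flip_class A \<in> carrier (aut_group M)" by (rule flip_class_carrier[OF A])
    obtain X\<^sub>g where Xg: "X\<^sub>g \<in> sets M" "X\<^sub>g \<subseteq> X\<^sub>0" "space M - X\<^sub>g \<in> null_sets M"
      and eq: "\<And>x. x \<in> X\<^sub>g \<Longrightarrow> \<alpha> (flip_class A, x) \<in> X\<^sub>0 \<and> \<Phi> (\<alpha> (flip_class A, x)) = \<beta> (flip_class A, \<Phi> x)"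
      using eqv[OF g] by blast
    have "ae_eq_rel M `` {\<lambda>x. \<alpha> (flip_class A, x)} = flip_class A"
      using assms(2) g unfolding natural_boolean_action_def by blast
    then have "(\<lambda>x. \<alpha> (flip_class A, x), flip A) \<in> ae_eq_rel M"
      using flip_mem_flip_class[OF A] by blast
    then have "AE x in M. \<alpha> (flip_class A, x) = flip A x" by (simp add: ae_eq_rel_def)
    moreover have "AE x in M. x \<in> X\<^sub>g"
      by (rule AE_I'[OF Xg(3)]) blast
    ultimately show ?thesis
    proof eventually_elim
      case (elim x)
      then show ?case using eq[of x] Xg(2) by auto
    qed
  qed
  \<comment> \<open>The null sets for the individual flips are united; this works for
    \<open>gen_sets\<close>, not for its closure.\<close>
  have "AE x in M. \<forall>A\<in>gen_sets. x \<in> X\<^sub>0 \<and> flip A x \<in> X\<^sub>0 \<and> \<Phi> (flip A x) = \<beta> (flip_class A, \<Phi> x)"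
    unfolding AE_ball_countable[OF countable_gen_sets] using equivariant gen_sets_inv_sets by blast
  then obtain x where x: "x \<in> B"
    and good: "\<And>A. A \<in> gen_sets \<Longrightarrow> x \<in> X\<^sub>0 \<and> flip A x \<in> X\<^sub>0 \<and> \<Phi> (flip A x) = \<beta> (flip_class A, \<Phi> x)"
  proof -
    assume *: thesis if "x \<in> B" "\<And>A. A \<in> gen_sets \<Longrightarrow> x \<in> X\<^sub>0 \<and> flip A x \<in> X\<^sub>0 \<and>
        \<Phi> (flip A x) = \<beta> (flip_class A, \<Phi> x)" for x
    assume "AE x in M. \<forall>A\<in>gen_sets. x \<in> X\<^sub>0 \<and> flip A x \<in> X\<^sub>0 \<and> \<Phi> (flip A x) = \<beta> (flip_class A, \<Phi> x)"
    then obtain Z where Z: "{x\<in>space M. \<not> (\<forall>A\<in>gen_sets. x \<in> X\<^sub>0 \<and> flip A x \<in> X\<^sub>0 \<and>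
        \<Phi> (flip A x) = \<beta> (flip_class A, \<Phi> x))} \<subseteq> Z" "emeasure M Z = 0" "Z \<in> sets M"
      by (rule AE_E)
    have "\<not> B \<subseteq> Z"
      using emeasure_mono[of B Z M] Z B_pos by auto
    then show thesis using * Z(1) sets.sets_into_space[OF B_sets] by blast
  qed
  obtain b where b: "b \<in> \<B>" "x \<in> b" using \<B>_small[OF x, of 1] by auto
  have b_gen: "b \<in> gen_sets" by (rule \<B>_gen_sets[OF b(1)])
  have xX0: "x \<in> X\<^sub>0" using good[OF b_gen] by blast
  define y where "y = \<Phi> x"
  have y: "y \<in> space N"
    using measurable_space[OF \<Phi>] xX0 sets.sets_into_space[OF X0]
    by (auto simp: y_def space_restrict_space)

  define a where "a = (\<lambda>A z. \<beta> (flip_class A, z))"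
  have bool: "boolean_action (aut_group M) (weak_topology M) N \<beta>"
    using spatial by (simp add: spatial_action_def)
  have cls: "flip_class A \<in> carrier (aut_group M)" if "A \<in> flip_group" for A
    using that by (intro flip_class_carrier flip_group_inv_sets)
  \<comment> \<open>Spatiality enters here and in the identity law below: these hold at every point,
    in particular at the chosen \<open>y\<close>, for all of \<open>flip_group\<close>.\<close>
  have a_action: "a (sym_diff A C) z = a A (a C z)"
    if "A \<in> flip_group" "C \<in> flip_group" "z \<in> space N" for A C z
    using spatial that cls flip_group_inv_sets unfolding spatial_action_def a_def
    by (simp add: flip_class_sym_diff)
  obtain E :: "nat \<Rightarrow> 'b set" where E: "\<And>n. E n \<in> sets N"
    and sep: "\<And>z w. z \<in> space N \<Longrightarrow> w \<in> space N \<Longrightarrow> (\<And>n. z \<in> E n \<longleftrightarrow> w \<in> E n) \<Longrightarrow> z = w"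
    using standard_borel_separating_sequence[of N] N unfolding standard_sigma_finite_space_def
    by metis
  have "a b y = y"
  proof (rule fixed_if_dense_stabiliser[where Y = "space N" and A = E and a = a])
    show "a A z \<in> space N" if "A \<in> flip_group" "z \<in> space N" for A z
    proof -
      have "mp_bijection N (\<lambda>z. \<beta> (flip_class A, z))"
        using bool cls[OF that(1)] unfolding boolean_action_def by blast
      then show ?thesis
        using that(2) unfolding mp_bijection_def a_def by (auto dest: bij_betwE)
    qed
    show "a A (a A z) = z" if "A \<in> flip_group" "z \<in> space N" for A z
    proof -
      have "a A (a A z) = a {} z" using a_action[of A A z] that by simp
      also have "\<dots> = z"
        using spatial that(2) by (simp add: a_def flip_class_empty spatial_action_def)
      finally show ?thesis .
    qed
    show "baire_property {A\<in>flip_group. a A y \<in> E n}" for n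
    proof -
      let ?V = "{g\<in>space (borel_of (weak_topology M)). \<beta> (g, y) \<in> E n}"
      have sp: "space (borel_of (weak_topology M)) = carrier (aut_group M)"
        unfolding borel_of_def by (simp add: space_measure_of_conv topspace_weak_topology)
      have "(\<lambda>g. \<beta> (g, y)) \<in> borel_of (weak_topology M) \<rightarrow>\<^sub>M N"
        using bool y unfolding boolean_action_def
        by (auto intro!: measurable_compose[OF measurable_Pair2'])
      then have V: "?V \<in> sets (borel_of (weak_topology M))"
        using measurable_sets[OF _ E[of n]] by (simp add: vimage_def Int_def conj_commute)
      have eq: "{A\<in>flip_group. a A y \<in> E n} = {A\<in>flip_group. flip_class A \<in> ?V}"
        using cls by (auto simp: a_def sp)
      show ?thesis unfolding eq by (rule baire_property_flip_class[OF V])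
    qed
    show "\<exists>C\<in>flip_group. a C y = y \<and> C \<in> pball A r" if "A \<in> flip_group" "0 < r" for A r
    proof -
      \<comment> \<open>Since \<open>C\<close> is in \<open>gen_sets\<close>, equivariance at
        \<open>x\<close> transfers \<open>flip C x = x\<close> to the model.\<close>
      obtain C where C: "C \<in> gen_sets" "flip C x = x" "C \<in> pball A r"
        using stabiliser_dense[OF x \<open>A \<in> flip_group\<close> \<open>0 < r\<close>] by blast
      then have "a C y = y" using good[of C] by (simp add: a_def y_def)
      then show ?thesis using C gen_sets_flip_group by blast
    qed
  qed (use y a_action sep b_gen gen_sets_flip_group in auto)
  \<comment> \<open>Both \<open>x\<close> and \<open>flip b x\<close> lie in
    \<open>X\<^sub>0\<close>, where \<Phi> is injective, so the fixed point in the model forces one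
    in \<open>B\<close>.\<close>
  then have "\<Phi> (flip b x) = \<Phi> x" using good[OF b_gen] by (simp add: a_def y_def)
  then have "flip b x = x" using inj good[OF b_gen] by (meson inj_onD)
  then show False using f_neq[OF x] b by (simp add: flip_def)
qed

end
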